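(* Let $p\in\{2,\infty\}$ and let $h\in H^p(\mathbb D)$ be non-zero. Then the NC Blaschke-Singular-Outer factorization of $h$ (with $d=1$ variable) and the classical Blaschke-Singular-Outer factorization of $h$ coincide (up to unimodular constants). That is, if $h=b\cdot s\cdot f$ is the classical Blaschke-Singular-Outer factorization of $h$, then the range of the multiplication operator $M_b$ on $H^2(\mathbb D)$ is the singularity space $\mathcal S(h)$ of $h$.
   Context: $H^2(\mathbb D)$ is the Hardy space of analytic functions on the unit disk with square-summable Taylor coefficients at $0$, and $H^\infty(\mathbb D)$ the bounded analytic functions. The classical factorization writes $h=bsf$ with $b$ a Blaschke inner, $s$ a singular inner (an inner function without zeros in $\mathbb D$), and $f\in H^p(\mathbb D)$ outer (cyclic for the shift $M_z$); an inner $\theta$ is (classically) Blaschke inner when $\{g\in H^2(\mathbb D): g/\theta\in\mathrm{Hol}(\mathbb D)\}=\theta H^2(\mathbb D)$. The factorization is unique up to unimodular constants. NC setting with $d=1$: put $\mathbb C^\infty:=\ell^2(\mathbb N)$, $\mathbb C^{\infty\times\infty}:=\mathcal L(\ell^2(\mathbb N))$. For $n\in\mathbb N\cup\{\infty\}$ and $Z\in\mathbb C^{n\times n}$ with $\|Z\|<1$, $h(Z)$ is defined by the (norm convergent) Taylor series of $h$ at $0$. Define $$\mathrm{Sing}(h)=\bigsqcup_{n\in\mathbb N\cup\{\infty\}}\{(Z,y): Z\in\mathbb C^{n\times n},\ \|Z\|<1,\ y\in\mathbb C^n,\ y^*h(Z)=0\},$$ $$\mathcal S(h)=\{g\in H^2(\mathbb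 D): y^*g(Z)=0\ \forall (Z,y)\in\mathrm{Sing}(h)\}.$$ An inner $\theta$ is NC Blaschke if $\theta H^2(\mathbb D)=\mathcal S(\theta)$, and NC singular if $\mathcal S(\theta)=H^2(\mathbb D)$. The NC Blaschke-Singular-Outer factorization of $h$ is the factorization $h=B\cdot S\cdot F$, unique up to unimodular constants, where $B$ is NC Blaschke inner with $\mathrm{Sing}(B)=\mathrm{Sing}(h)$, $S$ is NC singular inner and $F\in H^p(\mathbb D)$ is outer. *)

theory Defs
  imports "HOL-Complex_Analysis.Complex_Analysis" "HOL-Library.Extended_Nat"
begin

section \<open>The Hilbert space of square-summable complex sequences\<close>

typedef ell2 = "{x :: nat \<Rightarrow> complex. summable (\<lambda>i. (cmod (x i))\<^sup>2)}"
  morphisms ell2_nth Abs_ell2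
  by (rule exI[of _ "\<lambda>_. 0"]) simp

setup_lifting type_definition_ell2

lemma ell2_eqI: "(\<And>i. ell2_nth x i = ell2_nth y i) \<Longrightarrow> x = y"
  by (metis ell2_nth_inject ext)

lemma summable_ell2: "summable (\<lambda>i. (cmod (ell2_nth x i))\<^sup>2)"
  using ell2_nth[of x] by simp

lemma summable_cmod_mult:
  assumes "summable (\<lambda>i. (cmod (x i))\<^sup>2)" "summable (\<lambda>i. (cmod (y i))\<^sup>2)"
  shows "summable (\<lambda>i. cmod (x i) * cmod (y i))"
proof (rule summable_comparison_test')
  show "summable (\<lambda>i. (cmod (x i))\<^sup>2 + (cmod (y i))\<^sup>2)"
    using assms by (rule summable_add)
  fix i :: nat
  have "0 \<le> (cmod (x i) - cmod (y i))\<^sup>2" "0 \<le> cmod (x i) * cmod (y i)" by auto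
  then have "cmod (x i) * cmod (y i) \<le> (cmod (x i))\<^sup>2 + (cmod (y i))\<^sup>2"
    unfolding power2_diff by linarith
  then show "norm (cmod (x i) * cmod (y i)) \<le> (cmod (x i))\<^sup>2 + (cmod (y i))\<^sup>2"
    by simp
qed

lemma summable_cmod_add_sq:
  assumes "summable (\<lambda>i. (cmod (x i))\<^sup>2)" "summable (\<lambda>i. (cmod (y i))\<^sup>2)"
  shows "summable (\<lambda>i. (cmod (x i + y i))\<^sup>2)"
proof (rule summable_comparison_test')
  show "summable (\<lambda>i. (cmod (x i))\<^sup>2 + 2 * (cmod (x i) * cmod (y i)) + (cmod (y i))\<^sup>2)"
    using assms summable_cmod_mult[OF assms] by (intro summable_add summable_mult)
  fix i :: nat
  have "(cmod (x i + y i))\<^sup>2 \<le> (cmod (x i) + cmod (y i))\<^sup>2"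
    by (intro power_mono norm_triangle_ineq) simp
  then show "norm ((cmod (x i + y i))\<^sup>2)
      \<le> (cmod (x i))\<^sup>2 + 2 * (cmod (x i) * cmod (y i)) + (cmod (y i))\<^sup>2"
    by (simp add: power2_sum)
qed

lemma summable_ell2_inner: "summable (\<lambda>i. ell2_nth x i \<bullet> ell2_nth y i)"
  by (rule summable_comparison_test'[OF summable_cmod_mult[OF summable_ell2[of x] summable_ell2[of y]]])
     (simp add: Cauchy_Schwarz_ineq2)

instantiation ell2 :: real_inner
begin

lift_definition zero_ell2 :: ell2 is "\<lambda>_. 0" by simp
lift_definition plus_ell2 :: "ell2 \<Rightarrow> ell2 \<Rightarrow> ell2" is "\<lambda>x y i. x i + y i"
  by (rule summable_cmod_add_sq)
lift_definition uminus_ell2 :: "ell2 \<Rightarrow> ell2" is "\<lambda>x i. - x i" by simp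
lift_definition minus_ell2 :: "ell2 \<Rightarrow> ell2 \<Rightarrow> ell2" is "\<lambda>x y i. x i - y i"
  subgoal for x y using summable_cmod_add_sq[of x "\<lambda>i. - y i"] by simp
  done
lift_definition scaleR_ell2 :: "real \<Rightarrow> ell2 \<Rightarrow> ell2" is "\<lambda>c x i. c *\<^sub>R x i"
  by (simp add: power_mult_distrib summable_mult)

definition inner_ell2 :: "ell2 \<Rightarrow> ell2 \<Rightarrow> real" where
  "inner_ell2 x y = (\<Sum>i. ell2_nth x i \<bullet> ell2_nth y i)"
definition norm_ell2 :: "ell2 \<Rightarrow> real" where
  "norm_ell2 x = sqrt (\<Sum>i. (cmod (ell2_nth x i))\<^sup>2)"
definition dist_ell2 :: "ell2 \<Rightarrow> ell2 \<Rightarrow> real" where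
  "dist_ell2 x y = norm (x - y)"
definition sgn_ell2 :: "ell2 \<Rightarrow> ell2" where
  "sgn_ell2 x = scaleR (inverse (norm x)) x"
definition uniformity_ell2 :: "(ell2 \<times> ell2) filter" where
  "uniformity_ell2 = (INF e\<in>{0<..}. principal {(x, y). dist x y < e})"
definition open_ell2 :: "ell2 set \<Rightarrow> bool" where
  "open_ell2 U \<longleftrightarrow> (\<forall>x\<in>U. eventually (\<lambda>(x', y). x' = x \<longrightarrow> y \<in> U) uniformity)"

instance
proof
  fix x y z :: ell2 and a b :: real
  show "x + y + z = x + (y + z)" by transfer (simp add: add.assoc)
  show "x + y = y + x" by transfer (simp add: add.commute)
  show "0 + x = x" by transfer simp
  show "- x + x = 0" by transfer simp
  show "x - y = x + - y" by transfer simp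
  show "a *\<^sub>R (x + y) = a *\<^sub>R x + a *\<^sub>R y" by transfer (simp add: scaleR_right_distrib)
  show "(a + b) *\<^sub>R x = a *\<^sub>R x + b *\<^sub>R x" by transfer (simp add: scaleR_left_distrib)
  show "a *\<^sub>R b *\<^sub>R x = (a * b) *\<^sub>R x" by transfer simp
  show "1 *\<^sub>R x = x" by transfer simp
  show "dist x y = norm (x - y)" by (rule dist_ell2_def)
  show "sgn x = inverse (norm x) *\<^sub>R x" by (rule sgn_ell2_def)
  show "uniformity = (INF e\<in>{0<..}. principal {(x, y :: ell2). dist x y < e})"
    by (rule uniformity_ell2_def)
  show "open U \<longleftrightarrow> (\<forall>x\<in>U. eventually (\<lambda>(x', y). x' = x \<longrightarrow> y \<in> U) uniformity)" for U :: "ell2 set"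
    by (rule open_ell2_def)
  show "x \<bullet> y = y \<bullet> x" by (simp add: inner_ell2_def inner_commute)
  show "(x + y) \<bullet> z = x \<bullet> z + y \<bullet> z"
    by (simp add: inner_ell2_def plus_ell2.rep_eq inner_add_left suminf_add summable_ell2_inner)
  show "(a *\<^sub>R x) \<bullet> y = a * (x \<bullet> y)"
    by (simp add: inner_ell2_def scaleR_ell2.rep_eq suminf_mult summable_ell2_inner)
  show "0 \<le> x \<bullet> x" unfolding inner_ell2_def
    by (intro suminf_nonneg summable_ell2_inner) simp
  show "x \<bullet> x = 0 \<longleftrightarrow> x = 0"
  proof
    assume "x \<bullet> x = 0"
    then have "\<forall>i. ell2_nth x i \<bullet> ell2_nth x i = 0" unfolding inner_ell2_def
      by (subst (asm) suminf_eq_zero_iff[OF summable_ell2_inner]) auto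
    then show "x = 0" by (intro ell2_eqI) (simp add: zero_ell2.rep_eq)
  qed (simp add: inner_ell2_def zero_ell2.rep_eq)
  show "norm x = sqrt (x \<bullet> x)"
    by (simp add: norm_ell2_def inner_ell2_def power2_norm_eq_inner)
qed

end

lemma norm_ell2_sq: "(norm x)\<^sup>2 = (\<Sum>i. (cmod (ell2_nth x i))\<^sup>2)"
  by (simp add: norm_ell2_def suminf_nonneg summable_ell2)

lemma sum_ell2_nth_le: "(\<Sum>i<n. (cmod (ell2_nth x i))\<^sup>2) \<le> (norm x)\<^sup>2"
  unfolding norm_ell2_sq by (intro sum_le_suminf summable_ell2) auto

lemma ell2_nth_le_norm: "cmod (ell2_nth x i) \<le> norm x"
proof -
  have "(cmod (ell2_nth x i))\<^sup>2 \<le> (\<Sum>j<Suc i. (cmod (ell2_nth x j))\<^sup>2)"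
    by (simp add: sum_nonneg)
  also have "\<dots> \<le> (norm x)\<^sup>2" by (rule sum_ell2_nth_le)
  finally show ?thesis by (rule power2_le_imp_le) simp
qed

instance ell2 :: banach
proof
  fix X :: "nat \<Rightarrow> ell2" assume X: "Cauchy X"
  have "Cauchy (\<lambda>n. ell2_nth (X n) i)" for i
  proof (rule metric_CauchyI)
    fix e :: real assume "0 < e"
    then obtain M where "\<forall>m\<ge>M. \<forall>n\<ge>M. dist (X m) (X n) < e" using X by (meson metric_CauchyD)
    moreover have "dist (ell2_nth (X m) i) (ell2_nth (X n) i) \<le> dist (X m) (X n)" for m n
      using ell2_nth_le_norm[of "X m - X n" i] by (simp add: dist_norm minus_ell2.rep_eq)
    ultimately show "\<exists>M. \<forall>m\<ge>M. \<forall>n\<ge>M. dist (ell2_nth (X m) i) (ell2_nth (X n) i) < e"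
      by (meson le_less_trans)
  qed
  then have "\<exists>l. \<forall>i. (\<lambda>n. ell2_nth (X n) i) \<longlonglongrightarrow> l i"
    by (intro choice) (auto simp: Cauchy_convergent_iff convergent_def)
  then obtain l where l: "\<And>i. (\<lambda>n. ell2_nth (X n) i) \<longlonglongrightarrow> l i" by blast
  have fin: "(\<Sum>i<k. (cmod (ell2_nth (X m) i - l i))\<^sup>2) \<le> e\<^sup>2"
    if e: "\<forall>n\<ge>m. dist (X m) (X n) < e" for m e k
  proof (rule LIMSEQ_le_const2)
    show "(\<lambda>n. \<Sum>i<k. (cmod (ell2_nth (X m) i - ell2_nth (X n) i))\<^sup>2)
        \<longlonglongrightarrow> (\<Sum>i<k. (cmod (ell2_nth (X m) i - l i))\<^sup>2)"
      by (intro tendsto_intros l)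
    have "(\<Sum>i<k. (cmod (ell2_nth (X m) i - ell2_nth (X n) i))\<^sup>2) \<le> e\<^sup>2" if "n \<ge> m" for n
    proof -
      have "(\<Sum>i<k. (cmod (ell2_nth (X m) i - ell2_nth (X n) i))\<^sup>2) \<le> (norm (X m - X n))\<^sup>2"
        using sum_ell2_nth_le[of "X m - X n" k] by (simp add: minus_ell2.rep_eq)
      also have "\<dots> \<le> e\<^sup>2"
        using e that by (intro power_mono) (auto simp: dist_norm less_imp_le)
      finally show ?thesis .
    qed
    then show "\<exists>N. \<forall>n\<ge>N. (\<Sum>i<k. (cmod (ell2_nth (X m) i - ell2_nth (X n) i))\<^sup>2) \<le> e\<^sup>2" by blast
  qed
  have sm: "summable (\<lambda>i. (cmod (ell2_nth (X m) i - l i))\<^sup>2)"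
    if "\<forall>n\<ge>m. dist (X m) (X n) < e" for m e
  proof (rule bounded_imp_summable[where B = "e\<^sup>2"])
    fix n show "(\<Sum>i\<le>n. (cmod (ell2_nth (X m) i - l i))\<^sup>2) \<le> e\<^sup>2"
      using fin[OF that, of "Suc n"] by (simp only: lessThan_Suc_atMost)
  qed simp
  obtain M where M: "\<forall>m\<ge>M. \<forall>n\<ge>M. dist (X m) (X n) < 1" using X by (meson metric_CauchyD zero_less_one)
  have "summable (\<lambda>i. (cmod (ell2_nth (X M) i + - (ell2_nth (X M) i - l i)))\<^sup>2)"
    using sm[of M 1] M by (intro summable_cmod_add_sq summable_ell2) (auto simp: norm_minus_commute)
  then have "summable (\<lambda>i. (cmod (l i))\<^sup>2)" by simp
  then have L: "ell2_nth (Abs_ell2 l) = l" by (simp add: Abs_ell2_inverse)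
  have "X \<longlonglongrightarrow> Abs_ell2 l"
  proof (rule metric_LIMSEQ_I)
    fix r :: real assume r: "0 < r"
    then obtain N where N: "\<forall>m\<ge>N. \<forall>n\<ge>N. dist (X m) (X n) < r / 2"
      using X by (meson metric_CauchyD half_gt_zero)
    have "dist (X m) (Abs_ell2 l) < r" if "m \<ge> N" for m
    proof -
      have m: "\<forall>n\<ge>m. dist (X m) (X n) < r / 2" using N that by auto
      have "(norm (X m - Abs_ell2 l))\<^sup>2 \<le> (r / 2)\<^sup>2"
        unfolding norm_ell2_sq minus_ell2.rep_eq L
        using fin[OF m] sm[OF m] by (intro suminf_le_const) auto
      then have "norm (X m - Abs_ell2 l) \<le> r / 2" by (rule power2_le_imp_le) (use r in simp)
      then show ?thesis using r by (simp add: dist_norm)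
    qed
    then show "\<exists>N. \<forall>n\<ge>N. dist (X n) (Abs_ell2 l) < r" by blast
  qed
  then show "convergent X" by (auto simp: convergent_def)
qed

lift_definition ell2_scaleC :: "complex \<Rightarrow> ell2 \<Rightarrow> ell2" is "\<lambda>c x i. c * x i"
  by (simp add: norm_mult power_mult_distrib summable_mult)

lemma norm_ell2_scaleC: "norm (ell2_scaleC c x) = cmod c * norm x"
  by (simp add: norm_ell2_def ell2_scaleC.rep_eq norm_mult power_mult_distrib suminf_mult
      summable_ell2 real_sqrt_mult)

lift_definition scaleC_op :: "complex \<Rightarrow> ell2 \<Rightarrow>\<^sub>L ell2" is ell2_scaleC
  by (rule bounded_linear_intro[where K = "cmod c" for c])
     (auto intro!: ell2_eqI simp: ell2_scaleC.rep_eq plus_ell2.rep_eq scaleR_ell2.rep_eq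
       algebra_simps norm_ell2_scaleC)

text \<open>The scalar \<open>y\<^sup>* x\<close>.\<close>

definition ell2_cinner :: "ell2 \<Rightarrow> ell2 \<Rightarrow> complex" where
  "ell2_cinner y x = (\<Sum>i. cnj (ell2_nth y i) * ell2_nth x i)"


section \<open>Matrices of finite and infinite size and the functional calculus\<close>

text \<open>
  To let the size \<open>n \<in> \<nat> \<union> {\<infinity>}\<close> vary, \<open>\<complex>\<^sup>n\<close> is realized as the sequences in \<open>\<ell>\<^sup>2\<close> supported on the
  indices below \<open>n\<close>, and an \<open>n \<times> n\<close> matrix as the operator on \<open>\<ell>\<^sup>2\<close> having that matrix as its
  upper left corner and zeros elsewhere.  This does not change the operator norm.
  For \<open>n = \<infinity>\<close> this is all of \<open>\<ell>\<^sup>2\<close> and all of \<open>\<L>(\<ell>\<^sup>2)\<close>.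
\<close>

definition C_vec :: "enat \<Rightarrow> ell2 set" where
  "C_vec n = {x. \<forall>i. n \<le> enat i \<longrightarrow> ell2_nth x i = 0}"

text \<open>
  The type \<^typ>\<open>ell2 \<Rightarrow>\<^sub>L ell2\<close> consists of the bounded real-linear maps, so complex linearity
  has to be required separately.
\<close>

definition C_mat :: "enat \<Rightarrow> (ell2 \<Rightarrow>\<^sub>L ell2) set" where
  "C_mat n = {Z.
     (\<forall>c x. blinfun_apply Z (ell2_scaleC c x) = ell2_scaleC c (blinfun_apply Z x)) \<and>
     (\<forall>x. blinfun_apply Z x \<in> C_vec n) \<and>
     (\<forall>x. (\<forall>i. enat i < n \<longrightarrow> ell2_nth x i = 0) \<longrightarrow> blinfun_apply Z x = 0)}"

definition op_pow :: "(ell2 \<Rightarrow>\<^sub>L ell2) \<Rightarrow> nat \<Rightarrow> (ell2 \<Rightarrow>\<^sub>L ell2)" where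
  "op_pow Z k = (((o\<^sub>L) Z) ^^ k) id_blinfun"

definition taylor_coeff :: "(complex \<Rightarrow> complex) \<Rightarrow> nat \<Rightarrow> complex" where
  "taylor_coeff f k = (deriv ^^ k) f 0 / fact k"

text \<open>
  The sum is taken in the operator norm.  For \<open>Z \<in> \<complex>\<^sup>n\<^sup>\<times>\<^sup>n\<close> the zeroth term is the identity of
  \<open>\<ell>\<^sup>2\<close> rather than of \<open>\<complex>\<^sup>n\<close>; the result maps \<open>\<complex>\<^sup>n\<close> to itself, and its restriction
  to \<open>\<complex>\<^sup>n\<close> is \<open>f(Z)\<close>.
\<close>

definition op_eval :: "(complex \<Rightarrow> complex) \<Rightarrow> (ell2 \<Rightarrow>\<^sub>L ell2) \<Rightarrow> (ell2 \<Rightarrow>\<^sub>L ell2)" where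
  "op_eval f Z = (\<Sum>k. scaleC_op (taylor_coeff f k) o\<^sub>L op_pow Z k)"

definition left_annihilates ::
  "enat \<Rightarrow> ell2 \<Rightarrow> (complex \<Rightarrow> complex) \<Rightarrow> (ell2 \<Rightarrow>\<^sub>L ell2) \<Rightarrow> bool" where
  "left_annihilates n y f Z \<longleftrightarrow>
     (\<forall>x\<in>C_vec n. ell2_cinner y (blinfun_apply (op_eval f Z) x) = 0)"


section \<open>Hardy spaces\<close>

text \<open>
  A function on the disk is represented by any total function extending it.  The sets below
  depend only on the values on the disk, and equality of functions is always stated on the disk.
\<close>

abbreviation unit_disk :: "complex set" where
  "unit_disk \<equiv> ball 0 1"

definition H2 :: "(complex \<Rightarrow> complex) set" where
  "H2 = {f. f holomorphic_on unit_disk \<and> summable (\<lambda>k. (cmod (taylor_coeff f k))\<^sup>2)}"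

definition H2_norm :: "(complex \<Rightarrow> complex) \<Rightarrow> real" where
  "H2_norm f = sqrt (\<Sum>k. (cmod (taylor_coeff f k))\<^sup>2)"

definition Hinf :: "(complex \<Rightarrow> complex) set" where
  "Hinf = {f. f holomorphic_on unit_disk \<and> bounded (f ` unit_disk)}"

definition mult_range :: "(complex \<Rightarrow> complex) \<Rightarrow> (complex \<Rightarrow> complex) set" where
  "mult_range \<theta> = {g \<in> H2. \<exists>k\<in>H2. \<forall>z\<in>unit_disk. g z = \<theta> z * k z}"

definition inner_fun :: "(complex \<Rightarrow> complex) \<Rightarrow> bool" where
  "inner_fun \<theta> \<longleftrightarrow> \<theta> \<in> Hinf \<and>
     (AE t in lebesgue_on {0..2 * pi}.
        \<exists>w. cmod w = 1 \<and> ((\<lambda>r. \<theta> (of_real r * cis t)) \<longlongrightarrow> w) (at_left 1))"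

text \<open>
  Cyclicity for the shift on \<open>H\<^sup>2\<close>: the linear span of the functions \<open>z\<^sup>n f\<close> consists of the products
  of \<open>f\<close> with polynomials.
\<close>

definition outer_fun :: "(complex \<Rightarrow> complex) \<Rightarrow> bool" where
  "outer_fun f \<longleftrightarrow> f \<in> H2 \<and>
     (\<forall>g\<in>H2. \<forall>\<epsilon>>0. \<exists>q :: complex poly. H2_norm (\<lambda>z. g z - poly q z * f z) < \<epsilon>)"


section \<open>The classical factorization\<close>

text \<open>\<open>g/\<theta> \<in> Hol(\<D>)\<close>, where removable singularities at the zeros of \<open>\<theta>\<close> are filled in.\<close>

definition quotient_hol :: "(complex \<Rightarrow> complex) \<Rightarrow> (complex \<Rightarrow> complex) \<Rightarrow> bool" where
  "quotient_hol g \<theta> \<longleftrightarrow>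
     (\<exists>k. k holomorphic_on unit_disk \<and> (\<forall>z\<in>unit_disk. g z = \<theta> z * k z))"

definition blaschke_inner :: "(complex \<Rightarrow> complex) \<Rightarrow> bool" where
  "blaschke_inner \<theta> \<longleftrightarrow> inner_fun \<theta> \<and> {g \<in> H2. quotient_hol g \<theta>} = mult_range \<theta>"

definition singular_inner :: "(complex \<Rightarrow> complex) \<Rightarrow> bool" where
  "singular_inner \<theta> \<longleftrightarrow> inner_fun \<theta> \<and> (\<forall>z\<in>unit_disk. \<theta> z \<noteq> 0)"

definition classical_BSO ::
  "(complex \<Rightarrow> complex) set \<Rightarrow> (complex \<Rightarrow> complex) \<Rightarrow>
   (complex \<Rightarrow> complex) \<Rightarrow> (complex \<Rightarrow> complex) \<Rightarrow> (complex \<Rightarrow> complex) \<Rightarrow> bool" where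
  "classical_BSO Hp h b s f \<longleftrightarrow>
     blaschke_inner b \<and> singular_inner s \<and> f \<in> Hp \<and> outer_fun f \<and>
     (\<forall>z\<in>unit_disk. h z = b z * s z * f z)"


section \<open>The NC factorization in one variable\<close>

text \<open>The first component keeps the union over all sizes disjoint.\<close>

definition Sing :: "(complex \<Rightarrow> complex) \<Rightarrow> (enat \<times> (ell2 \<Rightarrow>\<^sub>L ell2) \<times> ell2) set" where
  "Sing h = {(n, Z, y). 0 < n \<and> Z \<in> C_mat n \<and> norm Z < 1 \<and> y \<in> C_vec n \<and>
                        left_annihilates n y h Z}"

definition sing_space :: "(complex \<Rightarrow> complex) \<Rightarrow> (complex \<Rightarrow> complex) set" where
  "sing_space h = {g \<in> H2. \<forall>(n, Z, y) \<in> Sing h. left_annihilates n y g Z}"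

definition NC_blaschke_inner :: "(complex \<Rightarrow> complex) \<Rightarrow> bool" where
  "NC_blaschke_inner \<theta> \<longleftrightarrow> inner_fun \<theta> \<and> mult_range \<theta> = sing_space \<theta>"

definition NC_singular_inner :: "(complex \<Rightarrow> complex) \<Rightarrow> bool" where
  "NC_singular_inner \<theta> \<longleftrightarrow> inner_fun \<theta> \<and> sing_space \<theta> = H2"

definition NC_BSO ::
  "(complex \<Rightarrow> complex) set \<Rightarrow> (complex \<Rightarrow> complex) \<Rightarrow>
   (complex \<Rightarrow> complex) \<Rightarrow> (complex \<Rightarrow> complex) \<Rightarrow> (complex \<Rightarrow> complex) \<Rightarrow> bool" where
  "NC_BSO Hp h B S F \<longleftrightarrow>
     NC_blaschke_inner B \<and> Sing B = Sing h \<and> NC_singular_inner S \<and> F \<in> Hp \<and> outer_fun F \<and>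
     (\<forall>z\<in>unit_disk. h z = B z * S z * F z)"

definition equal_up_to_unimodular :: "(complex \<Rightarrow> complex) \<Rightarrow> (complex \<Rightarrow> complex) \<Rightarrow> bool" where
  "equal_up_to_unimodular f g \<longleftrightarrow> (\<exists>c. cmod c = 1 \<and> (\<forall>z\<in>unit_disk. f z = c * g z))"

end

theory Submission
  imports Defs
begin

text \<open>
  Everything rests on one equivalence: for holomorphic \<open>g\<close> and \<open>h\<close> on the disk with \<open>h\<close> not
  identically zero, \<open>Sing h \<subseteq> Sing g\<close> holds if and only if \<open>g / h\<close> extends holomorphically to the
  disk.  So \<open>Sing h\<close> records exactly the zeros of \<open>h\<close> with their multiplicities, and the singularity
  space of \<open>h\<close> consists of all \<open>g \<in> H\<^sup>2\<close> that \<open>h\<close> divides (\<open>sing_space_eq\<close>).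

  If \<open>g = h k\<close>, then \<open>y\<^sup>* g(Z) x\<close> is the sum of the numbers \<open>k\<^sub>j y\<^sup>* h(Z) Z\<^sup>j x\<close>, hence \<open>g\<close> inherits
  the singularities of \<open>h\<close> (\<open>Sing_mono\<close>).  For the converse, matrices of infinite size provide a
  single convenient choice of \<open>Z\<close>: a multiple \<open>r\<close> of the unilateral shift, with \<open>r < 1\<close>.  Let
  \<open>\<rho> < r\<close> be such that \<open>h\<close> has no zero on the circle of radius \<open>\<rho>\<close>.  The functionals sending
  \<open>f\<close> to the integral of \<open>f(z) z\<^sup>j / h(z)\<close> over this circle, for all \<open>j\<close> at once, are realized by one
  vector \<open>y\<close> (\<open>annihilator_of_moments\<close>).  By Cauchy's theorem they vanish at \<open>h\<close>, hence they vanish at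
  \<open>g\<close>; and then the Cauchy transform of \<open>g / h\<close> is the quotient of \<open>g\<close> by \<open>h\<close> inside the circle
  (\<open>dvd_on_disk_if_moments_vanish\<close>).  Let \<open>\<rho>\<close> tend to \<open>1\<close>.

  Hence for functions that do not vanish identically, being NC Blaschke or NC singular means the same
  as being Blaschke or singular.
  In a factorization \<open>h = b s f\<close> the product \<open>s f\<close> has no zeros, so \<open>h\<close> and \<open>b\<close> divide each other,
  have the same singularities and the same singularity space \<open>b H\<^sup>2\<close>.

  Uniqueness uses that an inner \<open>\<theta>\<close> multiplies \<open>H\<^sup>2\<close> isometrically,
  in the form that \<open>\<theta>\<close> has norm at most \<open>1\<close> and that multiplication by \<open>\<theta>\<close> does not decrease norms.
  Both come from circle means of \<open>|\<theta> p|\<^sup>2\<close> for polynomials \<open>p\<close>, by dominated convergence.  If two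
  inner functions are multiples of each other with factors \<open>k, l \<in> H\<^sup>2\<close>, these factors have norm at most \<open>1\<close>
  and \<open>k(0) l(0) = 1\<close>, so that all the mass of \<open>k\<close> sits in its constant coefficient
  (\<open>inner_unique_if_mutual_multiples\<close>).  This applies to the Blaschke factors, which span the same
  space.  For the singular factors, cyclicity of \<open>f\<close> and closedness of \<open>S H\<^sup>2\<close> turn \<open>s f = c S F\<close>
  into \<open>s \<in> S H\<^sup>2\<close> (\<open>inner_multiple_if_outer\<close>).
\<close>

section \<open>Taylor coefficients on the disk\<close>

lemma taylor_sums:
  assumes "f holomorphic_on unit_disk" "cmod z < 1"
  shows "(\<lambda>k. taylor_coeff f k * z ^ k) sums f z"
  using holomorphic_power_series[OF assms(1), of z] assms(2) by (simp add: taylor_coeff_def)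

lemma taylor_coeff_unique:
  assumes "\<And>z. cmod z < 1 \<Longrightarrow> (\<lambda>k. a k * z ^ k) sums f z"
  shows "f holomorphic_on unit_disk" and "taylor_coeff f = a"
proof -
  show hol: "f holomorphic_on unit_disk"
    by (rule power_series_holomorphic[where a = a]) (use assms in simp)
  have s: "(\<lambda>k. (taylor_coeff f k - a k) * z ^ k) sums 0" if "cmod z < 1" for z
    using sums_diff[OF taylor_sums[OF hol that] assms[OF that]] by (simp add: algebra_simps)
  show "taylor_coeff f = a"
  proof (rule ccontr)
    define d where "d k = taylor_coeff f k - a k" for k
    assume "taylor_coeff f \<noteq> a"
    then obtain m where m: "d m \<noteq> 0" by (auto simp: d_def fun_eq_iff)
    show False
    proof (cases "m = 0")
      case True
      have "d 0 = 0" using s[of 0] sums_unique2[OF powser_sums_zero[of d]] by (auto simp: d_def)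
      with True m show False by simp
    next
      case False
      then have pos: "0 < m" by simp
      have ser: "(\<lambda>n. d n * (x - 0) ^ n) sums 0" if "cmod (x - 0) < 1" for x
        using s[of x] that by (simp add: d_def)
      have "\<exists>e>0. \<forall>z\<in>cball 0 e - {0::complex}. (0::complex) \<noteq> 0"
        by (rule powser_0_nonzero[OF zero_less_one ser refl m pos]) blast+
      then obtain e where "0 < e" and e: "\<forall>z\<in>cball 0 e - {0::complex}. (0::complex) \<noteq> 0"
        by auto
      then show False using e[rule_format, of "of_real e"] by simp
    qed
  qed
qed

lemma taylor_summable:
  assumes "f holomorphic_on unit_disk" "0 \<le> r" "r < 1"
  shows "summable (\<lambda>k. cmod (taylor_coeff f k) * r ^ k)"
proof -
  obtain s where s: "r < s" "s < 1" using dense assms(3) by blast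
  have "summable (\<lambda>k. taylor_coeff f k * of_real s ^ k)"
    using taylor_sums[OF assms(1), of "of_real s"] s assms(2) by (auto simp: sums_iff)
  from powser_insidea[OF this, of "of_real r"] s assms(2) show ?thesis
    by (simp add: norm_mult norm_power)
qed

lemma taylor_coeff_cong:
  assumes "f holomorphic_on unit_disk" "\<And>z. cmod z < 1 \<Longrightarrow> f z = g z"
  shows "taylor_coeff f = taylor_coeff g"
  by (rule taylor_coeff_unique(2)[symmetric]) (use taylor_sums[OF assms(1)] assms(2) in auto)

lemma taylor_coeff_diff:
  assumes "f holomorphic_on unit_disk" "g holomorphic_on unit_disk"
  shows "taylor_coeff (\<lambda>z. f z - g z) k = taylor_coeff f k - taylor_coeff g k"
  by (rule fun_cong[OF taylor_coeff_unique(2)])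
     (use sums_diff[OF taylor_sums[OF assms(1)] taylor_sums[OF assms(2)]] in \<open>simp add: algebra_simps\<close>)

lemma taylor_coeff_mult:
  assumes f: "f holomorphic_on unit_disk" and g: "g holomorphic_on unit_disk"
  shows "taylor_coeff (\<lambda>z. f z * g z) k = (\<Sum>i\<le>k. taylor_coeff f i * taylor_coeff g (k - i))"
proof (rule fun_cong[OF taylor_coeff_unique(2)])
  fix z :: complex assume z: "cmod z < 1"
  have abs: "summable (\<lambda>k. norm (taylor_coeff u k * z ^ k))" if "u holomorphic_on unit_disk" for u
    using taylor_summable[OF that _ z] by (simp add: norm_mult norm_power)
  have "(\<Sum>i\<le>k. (taylor_coeff f i * z ^ i) * (taylor_coeff g (k - i) * z ^ (k - i)))
      = (\<Sum>i\<le>k. taylor_coeff f i * taylor_coeff g (k - i)) * z ^ k" for k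
    unfolding sum_distrib_right
  proof (rule sum.cong)
    fix i assume "i \<in> {..k}"
    then have "z ^ k = z ^ i * z ^ (k - i)" by (simp add: power_add[symmetric])
    then show "(taylor_coeff f i * z ^ i) * (taylor_coeff g (k - i) * z ^ (k - i))
      = taylor_coeff f i * taylor_coeff g (k - i) * z ^ k" by simp
  qed simp
  with Cauchy_product_sums[OF abs[OF f] abs[OF g]]
  show "(\<lambda>k. (\<Sum>i\<le>k. taylor_coeff f i * taylor_coeff g (k - i)) * z ^ k) sums (f z * g z)"
    using sums_unique[OF taylor_sums[OF f z]] sums_unique[OF taylor_sums[OF g z]] by simp
qed

text \<open>
  Summing \<open>b\<^sub>j a\<^sub>i m\<^sub>j\<^sub>+\<^sub>i\<close> along antidiagonals or along rows.  With \<open>a\<close> and \<open>b\<close> the Taylor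
  coefficients of two functions and \<open>m\<^sub>k = y\<^sup>* Z\<^sup>k x\<close>, this is the multiplicativity of the functional
  calculus, tested against \<open>y\<close> and \<open>x\<close>.
\<close>

lemma sums_Cauchy_product_weighted:
  fixes a b m :: "nat \<Rightarrow> complex"
  assumes a: "summable (\<lambda>k. cmod (a k) * r ^ k)" and b: "summable (\<lambda>k. cmod (b k) * r ^ k)"
    and m: "\<And>k. cmod (m k) \<le> C * r ^ k" and r: "0 \<le> r"
  shows "(\<lambda>k. (\<Sum>i\<le>k. a i * b (k - i)) * m k) sums (\<Sum>j. b j * (\<Sum>i. a i * m (j + i)))"
proof -
  define F where "F = (\<lambda>(j,i). b j * (a i * m (j + i)))"
  have C: "0 \<le> C" using m[of 0] norm_ge_zero[of "m 0"] by (simp del: norm_ge_zero)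
  have le: "cmod (F (j, i)) \<le> (cmod (b j) * r ^ j) * (C * (cmod (a i) * r ^ i))" for j i
  proof -
    have "cmod (F (j, i)) = cmod (b j) * (cmod (a i) * cmod (m (j + i)))"
      by (simp add: F_def norm_mult)
    also have "\<dots> \<le> cmod (b j) * (cmod (a i) * (C * r ^ (j + i)))"
      by (intro mult_left_mono m) auto
    finally show ?thesis by (simp add: power_add mult_ac)
  qed
  have hs: "(f has_sum suminf f) UNIV" if "summable f" "\<And>x. 0 \<le> f x" for f :: "nat \<Rightarrow> real"
    using that summable_on_UNIV_nonneg_real_iff[of f]
    by (metis has_sum_infsum has_sum_imp_sums sums_unique)
  \<comment> \<open>The bound \<open>C r\<^sup>j\<^sup>+\<^sup>i\<close> splits, so the double series is dominated by a product of two convergent series.\<close>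
  have sum2: "(\<lambda>(j,i). (cmod (b j) * r ^ j) * (C * (cmod (a i) * r ^ i))) summable_on (UNIV \<times> UNIV)"
  proof (rule summable_on_SigmaI)
    show "((\<lambda>i. case (j, i) of (j,i) \<Rightarrow> (cmod (b j) * r ^ j) * (C * (cmod (a i) * r ^ i)))
        has_sum (cmod (b j) * r ^ j) * (C * (\<Sum>i. cmod (a i) * r ^ i))) UNIV" for j
      unfolding prod.case by (intro has_sum_cmult_right hs a) (simp add: r)
    show "(\<lambda>j. (cmod (b j) * r ^ j) * (C * (\<Sum>i. cmod (a i) * r ^ i))) summable_on UNIV"
      by (intro summable_on_cmult_left has_sum_imp_summable[OF hs[OF b]]) (simp add: r)
  qed (simp add: r C)
  have F_abs: "(\<lambda>x. norm (F x)) summable_on (UNIV \<times> UNIV)"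
    by (rule summable_on_comparison_test[OF sum2]) (use le in auto)
  have F: "(F has_sum infsum F (UNIV \<times> UNIV)) (UNIV \<times> UNIV)"
    using abs_summable_summable[OF F_abs] by (rule has_sum_infsum)
  have row: "((\<lambda>i. F (j, i)) has_sum b j * (\<Sum>i. a i * m (j + i))) UNIV" for j
  proof -
    have smb: "summable (\<lambda>i. norm (a i * m (j + i)))"
    proof (rule summable_comparison_test')
      show "summable (\<lambda>i. (C * r ^ j) * (cmod (a i) * r ^ i))" by (intro summable_mult a)
      show "norm (norm (a i * m (j + i))) \<le> (C * r ^ j) * (cmod (a i) * r ^ i)" for i
        using mult_left_mono[OF m[of "j + i"], of "cmod (a i)"]
        by (simp add: norm_mult power_add mult_ac)
    qed
    have "((\<lambda>i. a i * m (j + i)) has_sum (\<Sum>i. a i * m (j + i))) UNIV"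
      by (rule norm_summable_imp_has_sum[OF smb summable_sums[OF summable_norm_cancel[OF smb]]])
    then show ?thesis unfolding F_def prod.case by (rule has_sum_cmult_right)
  qed
  have rows: "((\<lambda>j. b j * (\<Sum>i. a i * m (j + i))) has_sum infsum F (UNIV \<times> UNIV)) UNIV"
    by (rule has_sum_SigmaD[OF F row])
  have "((\<lambda>(k,i). F (k - i, i)) has_sum infsum F (UNIV \<times> UNIV)) (SIGMA k:UNIV. {..k})"
    using F by (subst has_sum_reindex_bij_witness[where i = "\<lambda>(j,i). (j + i, i)"
        and j = "\<lambda>(k,i). (k - i, i)" and T = "UNIV \<times> UNIV" and h = F]) auto
  then have "((\<lambda>k. \<Sum>i\<le>k. F (k - i, i)) has_sum infsum F (UNIV \<times> UNIV)) UNIV"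
    by (rule has_sum_SigmaD) (auto intro: has_sum_finite)
  moreover have "(\<Sum>i\<le>k. F (k - i, i)) = (\<Sum>i\<le>k. a i * b (k - i)) * m k" for k
    unfolding F_def sum_distrib_right by (intro sum.cong) auto
  ultimately have "((\<lambda>k. (\<Sum>i\<le>k. a i * b (k - i)) * m k) has_sum infsum F (UNIV \<times> UNIV)) UNIV"
    by simp
  then show "(\<lambda>k. (\<Sum>i\<le>k. a i * b (k - i)) * m k) sums (\<Sum>j. b j * (\<Sum>i. a i * m (j + i)))"
    unfolding sums_unique[OF has_sum_imp_sums[OF rows], symmetric] by (rule has_sum_imp_sums)
qed

section \<open>Multiples of a function inherit its singularities\<close>

text \<open>
  The complex pairing in terms of the real inner product, from which it inherits boundedness.
\<close>

lemma ell2_cinner_eq: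
  "ell2_cinner y x = Complex (y \<bullet> x) (ell2_scaleC \<i> y \<bullet> x)"
proof -
  have s: "summable (\<lambda>i. cnj (ell2_nth y i) * ell2_nth x i)"
    using summable_cmod_mult[OF summable_ell2[of y] summable_ell2[of x]]
    by (intro summable_norm_cancel[where f = "\<lambda>i. cnj (ell2_nth y i) * ell2_nth x i"])
       (simp add: norm_mult)
  show ?thesis
    unfolding ell2_cinner_def
    by (intro complex_eqI)
       (simp_all only: Re_suminf[OF s] Im_suminf[OF s] inner_ell2_def inner_complex_def
          ell2_scaleC.rep_eq complex.sel, simp_all add: algebra_simps)
qed

lemma bounded_linear_ell2_cinner: "bounded_linear (ell2_cinner y)"
proof -
  have "ell2_cinner y = (\<lambda>x. of_real (y \<bullet> x) + \<i> * of_real (ell2_scaleC \<i> y \<bullet> x))"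
    by (simp add: fun_eq_iff ell2_cinner_eq complex_eq_iff)
  moreover have "bounded_linear (\<lambda>x. of_real (y \<bullet> x) + \<i> * of_real (ell2_scaleC \<i> y \<bullet> x) :: complex)"
    by (intro bounded_linear_add bounded_linear_const_mult bounded_linear_inner_right
        bounded_linear_compose[OF bounded_linear_of_real])
  ultimately show ?thesis by simp
qed

lemma ell2_cinner_scaleC: "ell2_cinner y (ell2_scaleC c x) = c * ell2_cinner y x"
proof -
  have s: "summable (\<lambda>i. cnj (ell2_nth y i) * ell2_nth x i)"
    using summable_cmod_mult[OF summable_ell2[of y] summable_ell2[of x]]
    by (intro summable_norm_cancel[where f = "\<lambda>i. cnj (ell2_nth y i) * ell2_nth x i"])
       (simp add: norm_mult)
  show ?thesis
    using suminf_mult[OF s, of c] by (simp add: ell2_cinner_def ell2_scaleC.rep_eq mult_ac)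
qed

lemma op_pow_apply: "blinfun_apply (op_pow Z k) x = (blinfun_apply Z ^^ k) x"
  by (induction k) (simp_all add: op_pow_def)

lemma norm_op_pow_apply_le: "norm (blinfun_apply (op_pow Z k) x) \<le> norm Z ^ k * norm x"
proof (induction k)
  case (Suc k)
  have "norm (blinfun_apply (op_pow Z (Suc k)) x) \<le> norm Z * norm (blinfun_apply (op_pow Z k) x)"
    unfolding op_pow_apply using norm_blinfun by simp
  also have "\<dots> \<le> norm Z * (norm Z ^ k * norm x)" by (intro mult_left_mono Suc.IH) simp
  finally show ?case by simp
qed (simp add: op_pow_apply)

lemma norm_scaleC_op_pow_le: "norm (scaleC_op c o\<^sub>L op_pow Z k) \<le> cmod c * norm Z ^ k"
proof (rule norm_blinfun_bound)
  fix x
  show "norm (blinfun_apply (scaleC_op c o\<^sub>L op_pow Z k) x) \<le> cmod c * norm Z ^ k * norm x"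
    using mult_left_mono[OF norm_op_pow_apply_le[of Z k x], of "cmod c"]
    by (simp add: scaleC_op.rep_eq norm_ell2_scaleC mult.assoc)
qed simp

lemma ell2_cinner_op_eval:
  assumes "f holomorphic_on unit_disk" "norm Z < 1"
  shows "(\<lambda>k. taylor_coeff f k * ell2_cinner y (blinfun_apply (op_pow Z k) x))
           sums ell2_cinner y (blinfun_apply (op_eval f Z) x)"
proof -
  have "summable (\<lambda>k. scaleC_op (taylor_coeff f k) o\<^sub>L op_pow Z k)"
    by (rule summable_comparison_test'[OF taylor_summable[OF assms(1) norm_ge_zero assms(2)]])
       (rule norm_scaleC_op_pow_le)
  then have "(\<lambda>k. scaleC_op (taylor_coeff f k) o\<^sub>L op_pow Z k) sums op_eval f Z"
    unfolding op_eval_def by (rule summable_sums)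
  from bounded_linear.sums[OF bounded_linear_ell2_cinner
      bounded_linear.sums[OF blinfun.bounded_linear_left this, of x], of y]
  show ?thesis by (simp add: scaleC_op.rep_eq ell2_cinner_scaleC)
qed

text \<open>
  In this form the condition speaks of scalar series, which can be multiplied by Cauchy's rule.
\<close>

lemma left_annihilates_iff:
  assumes "f holomorphic_on unit_disk" "norm Z < 1"
  shows "left_annihilates n y f Z \<longleftrightarrow>
    (\<forall>x\<in>C_vec n. (\<Sum>k. taylor_coeff f k * ell2_cinner y (blinfun_apply (op_pow Z k) x)) = 0)"
  using sums_unique[OF ell2_cinner_op_eval[OF assms]] by (simp add: left_annihilates_def)

lemma op_pow_C_vec: "Z \<in> C_mat n \<Longrightarrow> x \<in> C_vec n \<Longrightarrow> blinfun_apply (op_pow Z k) x \<in> C_vec n"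
  by (induction k) (auto simp: op_pow_apply C_mat_def)

text \<open>
  If \<open>y\<^sup>* h(Z)\<close> vanishes on \<open>\<complex>\<^sup>n\<close>, it vanishes at all \<open>Z\<^sup>j x\<close>; weighting these equations
  with the Taylor coefficients of \<open>k\<close> gives \<open>y\<^sup>* (h k)(Z) x = 0\<close>.
\<close>

lemma Sing_mono:
  assumes h: "h holomorphic_on unit_disk" and g: "g holomorphic_on unit_disk"
    and dvd: "quotient_hol g h"
  shows "Sing h \<subseteq> Sing g"
proof -
  obtain k where k: "k holomorphic_on unit_disk" and gk: "\<And>z. cmod z < 1 \<Longrightarrow> g z = h z * k z"
    using dvd by (auto simp: quotient_hol_def)
  have "left_annihilates n y g Z"
    if Z: "Z \<in> C_mat n" "norm Z < 1" and y: "left_annihilates n y h Z" for n Z y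
    unfolding left_annihilates_iff[OF g Z(2)]
  proof
    fix x assume x: "x \<in> C_vec n"
    define m where "m k = ell2_cinner y (blinfun_apply (op_pow Z k) x)" for k
    obtain K where K: "0 \<le> K" "\<And>v. cmod (ell2_cinner y v) \<le> K * norm v"
      using bounded_linear.nonneg_bounded[OF bounded_linear_ell2_cinner] by (metis mult.commute)
    have bound: "cmod (m k) \<le> K * norm x * norm Z ^ k" for k
      using order_trans[OF K(2) mult_left_mono[OF norm_op_pow_apply_le K(1)], of Z k x]
      by (simp add: m_def mult_ac)
    have "(\<Sum>i. taylor_coeff h i * m (j + i)) = 0" for j
      using y op_pow_C_vec[OF Z(1) x, of j]
      unfolding left_annihilates_iff[OF h Z(2)] m_def
      by (simp add: op_pow_apply funpow_add add.commute[of j])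
    then have "(\<lambda>n. (\<Sum>i\<le>n. taylor_coeff h i * taylor_coeff k (n - i)) * m n) sums 0"
      using sums_Cauchy_product_weighted[OF taylor_summable[OF h norm_ge_zero Z(2)]
          taylor_summable[OF k norm_ge_zero Z(2)] bound norm_ge_zero] by simp
    moreover have "taylor_coeff g n = (\<Sum>i\<le>n. taylor_coeff h i * taylor_coeff k (n - i))" for n
      using taylor_coeff_cong[OF g gk] taylor_coeff_mult[OF h k] by simp
    ultimately show "(\<Sum>k. taylor_coeff g k * ell2_cinner y (blinfun_apply (op_pow Z k) x)) = 0"
      using sums_unique by (fastforce simp: m_def)
  qed
  then show ?thesis by (auto simp: Sing_def)
qed

section \<open>Divisibility from vanishing moments on a circle\<close>

lemma contour_integrable_circlepath_if_continuous:
  "0 \<le> \<rho> \<Longrightarrow> continuous_on (sphere 0 \<rho>) f \<Longrightarrow> f contour_integrable_on circlepath 0 \<rho>"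
  by (rule contour_integrable_continuous_circlepath) simp

text \<open>
  The Taylor series of \<open>D\<close> converges uniformly on the circle, so it may be integrated term by term.
\<close>

lemma contour_moments_sums:
  assumes \<rho>: "0 < \<rho>" "\<rho> < 1" and \<phi>: "continuous_on (sphere 0 \<rho>) \<phi>"
    and D: "D holomorphic_on unit_disk"
  shows "(\<lambda>j. taylor_coeff D j * contour_integral (circlepath 0 \<rho>) (\<lambda>z. \<phi> z * z ^ j))
           sums contour_integral (circlepath 0 \<rho>) (\<lambda>z. \<phi> z * D z)"
proof -
  have "bounded (\<phi> ` sphere 0 \<rho>)"
    by (rule compact_imp_bounded[OF compact_continuous_image[OF \<phi> compact_sphere]])
  then obtain M where "\<forall>w\<in>\<phi> ` sphere 0 \<rho>. cmod w \<le> M" unfolding bounded_iff ..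
  then have M: "cmod (\<phi> z) \<le> M" if "z \<in> sphere 0 \<rho>" for z
    using imageI[OF that, of \<phi>] by (rule bspec)
  have ci: "(\<lambda>z. taylor_coeff D j * (\<phi> z * z ^ j)) contour_integrable_on circlepath 0 \<rho>" for j
    using \<rho> by (intro contour_integrable_circlepath_if_continuous continuous_intros \<phi>) auto
  have ci': "(\<lambda>z. \<phi> z * z ^ j) contour_integrable_on circlepath 0 \<rho>" for j
    using \<rho> by (intro contour_integrable_circlepath_if_continuous continuous_intros \<phi>) auto
  have "uniform_limit (sphere 0 \<rho>) (\<lambda>n z. \<Sum>j<n. taylor_coeff D j * (\<phi> z * z ^ j))
      (\<lambda>z. \<Sum>j. taylor_coeff D j * (\<phi> z * z ^ j)) sequentially"
  proof (rule Weierstrass_m_test)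
    show "summable (\<lambda>j. M * (cmod (taylor_coeff D j) * \<rho> ^ j))"
      using \<rho> by (intro summable_mult taylor_summable D) auto
    fix j z assume "(z::complex) \<in> sphere 0 \<rho>"
    then show "norm (taylor_coeff D j * (\<phi> z * z ^ j)) \<le> M * (cmod (taylor_coeff D j) * \<rho> ^ j)"
      using mult_right_mono[OF M, of z "cmod (taylor_coeff D j) * \<rho> ^ j"] \<rho>
      by (simp add: norm_mult norm_power mult_ac)
  qed
  also have "?this \<longleftrightarrow> uniform_limit (sphere 0 \<rho>)
      (\<lambda>n z. \<Sum>j<n. taylor_coeff D j * (\<phi> z * z ^ j)) (\<lambda>z. \<phi> z * D z) sequentially"
  proof (rule uniform_limit_cong')
    fix z :: complex assume "z \<in> sphere 0 \<rho>"
    then have "(\<lambda>j. \<phi> z * (taylor_coeff D j * z ^ j)) sums (\<phi> z * D z)"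
      using \<rho> by (intro sums_mult taylor_sums D) auto
    then show "(\<Sum>j. taylor_coeff D j * (\<phi> z * z ^ j)) = \<phi> z * D z"
      by (simp add: sums_iff mult_ac)
  qed simp
  finally have ul: "uniform_limit (sphere 0 \<rho>)
      (\<lambda>n z. \<Sum>j<n. taylor_coeff D j * (\<phi> z * z ^ j)) (\<lambda>z. \<phi> z * D z) sequentially" .
  have "(\<lambda>n. contour_integral (circlepath 0 \<rho>) (\<lambda>z. \<Sum>j<n. taylor_coeff D j * (\<phi> z * z ^ j)))
      \<longlonglongrightarrow> contour_integral (circlepath 0 \<rho>) (\<lambda>z. \<phi> z * D z)"
    by (rule contour_integral_uniform_limit_circlepath(2)[OF _ ul])
       (use \<rho> ci in \<open>auto intro!: contour_integrable_sum always_eventually\<close>)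
  then show ?thesis
    unfolding sums_def by (simp add: contour_integral_sum ci contour_integral_lmul ci')
qed

text \<open>
  The quotient is \<open>k(w) = (2 \<pi> \<i>)\<^sup>-\<^sup>1 \<integral> g(z) / (h(z) (z - w)) dz\<close>.  By Cauchy's formula for \<open>g\<close>, the
  difference \<open>g(w) - h(w) k(w)\<close> is the integral of \<open>g / h\<close> times the divided difference
  \<open>(h(z) - h(w)) / (z - w)\<close>.  The latter is a power series in \<open>z\<close>, so the integral is a combination of
  the moments.  The divided difference thus deals with zeros of all multiplicities at once.
\<close>

lemma dvd_on_disk_if_moments_vanish:
  assumes \<rho>: "0 < \<rho>" "\<rho> < 1" and h: "h holomorphic_on unit_disk" and g: "g holomorphic_on unit_disk"
    and nz: "\<And>z. cmod z = \<rho> \<Longrightarrow> h z \<noteq> 0"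
    and moments: "\<And>j. contour_integral (circlepath 0 \<rho>) (\<lambda>z. g z / h z * z ^ j) = 0"
  shows "\<exists>k. k holomorphic_on ball 0 \<rho> \<and> (\<forall>z\<in>ball 0 \<rho>. g z = h z * k z)"
proof -
  have sub: "sphere 0 \<rho> \<subseteq> unit_disk" "cball 0 \<rho> \<subseteq> unit_disk" using \<rho> by auto
  have conth: "continuous_on (sphere 0 \<rho>) h" and contg: "continuous_on (sphere 0 \<rho>) g"
    using holomorphic_on_imp_continuous_on[OF h] holomorphic_on_imp_continuous_on[OF g]
      continuous_on_subset sub by blast+
  define q where "q z = g z / h z" for z
  have contq: "continuous_on (sphere 0 \<rho>) q"
    unfolding q_def using nz by (intro continuous_intros contg conth) auto
  define K where "K w = contour_integral (circlepath 0 \<rho>) (\<lambda>z. q z / (z - w))" for w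
  have ciq: "(\<lambda>z. q z / (z - w)) contour_integrable_on circlepath 0 \<rho>" if "w \<in> ball 0 \<rho>" for w
    using \<rho> that by (intro contour_integrable_circlepath_if_continuous continuous_intros contq) auto
  have K: "((\<lambda>z. q z / (z - w) ^ 1) has_contour_integral K w) (circlepath 0 \<rho>)" if "w \<in> ball 0 \<rho>" for w
    using has_contour_integral_integral[OF ciq[OF that]] by (simp add: K_def)
  have "(K has_field_derivative (of_nat 1 * contour_integral (circlepath 0 \<rho>) (\<lambda>z. q z / (z - w) ^ Suc 1))) (at w)"
    if "w \<in> ball 0 \<rho>" for w
    using Cauchy_next_derivative_circlepath(2)[OF _ K _ that] contq \<rho> by simp
  then have holK: "K holomorphic_on ball 0 \<rho>"
    by (auto simp only: holomorphic_on_open[OF open_ball] intro: exI)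
  have eq: "2 * pi * \<i> * g w = h w * K w" if w: "w \<in> ball 0 \<rho>" for w
  proof -
    \<comment> \<open>The divided difference of \<open>h\<close> at \<open>w\<close>, a holomorphic function on the whole disk.\<close>
    define D where "D z = (if z = w then deriv h w else (h z - h w) / (z - w))" for z
    have D: "D holomorphic_on unit_disk" unfolding D_def by (rule pole_lemma_open[OF h]) simp
    have "(\<lambda>j. 0) sums contour_integral (circlepath 0 \<rho>) (\<lambda>z. q z * D z)"
      using contour_moments_sums[OF \<rho> contq D] moments by (simp add: q_def)
    then have "contour_integral (circlepath 0 \<rho>) (\<lambda>z. q z * D z) = 0"
      using sums_unique2 sums_zero by blast
    moreover have "contour_integral (circlepath 0 \<rho>) (\<lambda>z. q z * D z)
        = contour_integral (circlepath 0 \<rho>) (\<lambda>z. g z / (z - w) - h w * (q z / (z - w)))"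
    proof (rule contour_integral_eq)
      fix z assume "z \<in> path_image (circlepath 0 \<rho>)"
      then have z: "cmod z = \<rho>" "z \<noteq> w" using \<rho> w by auto
      with nz[of z] show "q z * D z = g z / (z - w) - h w * (q z / (z - w))"
        by (simp add: q_def D_def diff_divide_distrib right_diff_distrib)
    qed
    moreover have "((\<lambda>z. g z / (z - w)) has_contour_integral (2 * pi * \<i> * g w)) (circlepath 0 \<rho>)"
      using w Cauchy_integral_circlepath[of 0 \<rho> g w,
          OF continuous_on_subset[OF holomorphic_on_imp_continuous_on[OF g] sub(2)]
             holomorphic_on_subset[OF g order_trans[OF ball_subset_cball sub(2)]]] by simp
    then have "((\<lambda>z. g z / (z - w) - h w * (q z / (z - w))) has_contour_integral
        (2 * pi * \<i> * g w - h w * K w)) (circlepath 0 \<rho>)"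
      using has_contour_integral_lmul[OF K[OF w], of "h w"] by (intro has_contour_integral_diff) simp_all
    ultimately show ?thesis by (simp add: contour_integral_unique)
  qed
  have "(\<lambda>z. K z / (2 * pi * \<i>)) holomorphic_on ball 0 \<rho>" by (intro holomorphic_intros holK) simp
  moreover have "g z = h z * (K z / (2 * pi * \<i>))" if "z \<in> ball 0 \<rho>" for z
    using eq[OF that] by (simp add: field_simps)
  ultimately show ?thesis by blast
qed

text \<open>
  The local quotients agree where \<open>h \<noteq> 0\<close>, hence each of them is \<open>g / h\<close> with its removable
  singularities filled in.
\<close>

lemma quotient_hol_exhaust:
  assumes h: "h holomorphic_on unit_disk" and nz: "\<exists>z\<in>unit_disk. h z \<noteq> 0"
    and loc: "\<And>r. r < 1 \<Longrightarrow> \<exists>\<rho>>r. \<rho> < 1 \<and> (\<exists>k. k holomorphic_on ball 0 \<rho> \<and> (\<forall>z\<in>ball 0 \<rho>. g z = h z * k z))"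
  shows "quotient_hol g h"
proof -
  define k where "k = remove_sings (\<lambda>z. g z / h z)"
  have "k analytic_on {z} \<and> g z = h z * k z" if z: "z \<in> unit_disk" for z
  proof -
    from loc[of "cmod z"] z obtain \<rho> k' where \<rho>: "cmod z < \<rho>" "\<rho> < 1" and k': "k' holomorphic_on ball 0 \<rho>"
      and gk: "\<And>z. z \<in> ball 0 \<rho> \<Longrightarrow> g z = h z * k' z" by auto
    have zb: "z \<in> ball 0 \<rho>" using \<rho> by simp
    have eq: "k w = k' w" if w: "w \<in> ball 0 \<rho>" for w
      unfolding k_def
    proof (rule remove_sings_eqI)
      have lim_k': "k' \<midarrow>w\<rightarrow> k' w"
        using continuous_on_eq_continuous_at[OF open_ball, of 0 \<rho> k']
          holomorphic_on_imp_continuous_on[OF k'] w by (simp add: isCont_def)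
      have "\<forall>\<^sub>F z in at w. h z \<noteq> 0"
      proof -
        have "\<not> w islimpt {z\<in>unit_disk. h z = 0}"
        proof (rule notI)
          assume lim: "w islimpt {z\<in>unit_disk. h z = 0}"
          have "h z = 0" if "z \<in> unit_disk" for z
            by (rule analytic_continuation[OF h open_ball connected_ball _ _ lim _ that]) (use w \<rho> in auto)
          with nz show False by blast
        qed
        then have "\<forall>\<^sub>F z in at w. z \<notin> {z\<in>unit_disk. h z = 0}"
          by (simp add: islimpt_iff_eventually)
        moreover have "\<forall>\<^sub>F z in at w. z \<in> unit_disk"
          using w \<rho> by (intro eventually_at_in_open') auto
        ultimately show ?thesis by eventually_elim auto
      qed
      moreover have "\<forall>\<^sub>F z in at w. z \<in> ball 0 \<rho>"
        using w by (intro eventually_at_in_open') auto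
      ultimately have "\<forall>\<^sub>F z in at w. k' z = g z / h z"
        by eventually_elim (simp add: gk)
      with lim_k' show "(\<lambda>z. g z / h z) \<midarrow>w\<rightarrow> k' w"
        by (rule Lim_transform_eventually)
    qed
    have "k holomorphic_on ball 0 \<rho>" by (rule holomorphic_transform[OF k']) (simp add: eq)
    then have "k analytic_on {z}" using zb by (meson analytic_at open_ball)
    with eq[OF zb] gk[OF zb] show ?thesis by simp
  qed
  then show ?thesis
    unfolding quotient_hol_def by (metis analytic_imp_holomorphic analytic_on_analytic_at)
qed

text \<open>
  A compact disk contains finitely many zeros, which exclude finitely many radii.
\<close>

lemma exists_zero_free_circle:
  assumes h: "h holomorphic_on unit_disk" and nz: "\<exists>z\<in>unit_disk. h z \<noteq> 0" and r: "r < 1"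
  shows "\<exists>\<rho>. r < \<rho> \<and> 0 < \<rho> \<and> \<rho> < 1 \<and> (\<forall>z. cmod z = \<rho> \<longrightarrow> h z \<noteq> 0)"
proof (cases "h constant_on unit_disk")
  case True
  then show ?thesis using nz dense[of "max r 0" 1] r by (auto simp: constant_on_def)
next
  case False
  define s where "s = (max r 0 + 1) / 2"
  have s: "max r 0 < s" "s < 1" using r by (auto simp: s_def)
  have "finite {z\<in>cball 0 s. h z = 0}"
    by (rule holomorphic_compact_finite_zeros[OF h _ _ _ _ False]) (use s in auto)
  then have "finite (cmod ` {z\<in>cball 0 s. h z = 0})" by (rule finite_imageI)
  moreover have "infinite {max r 0 <..< s}" using s by (simp add: infinite_Ioo)
  ultimately have "\<not> {max r 0 <..< s} \<subseteq> cmod ` {z\<in>cball 0 s. h z = 0}"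
    using finite_subset by blast
  then obtain \<rho> where "\<rho> \<in> {max r 0 <..< s}" "\<rho> \<notin> cmod ` {z\<in>cball 0 s. h z = 0}"
    unfolding subset_iff by blast
  then show ?thesis using s by (intro exI[of _ \<rho>]) auto
qed

section \<open>The shift detects divisibility\<close>

lift_definition right_shift :: "ell2 \<Rightarrow> ell2" is "\<lambda>x i. case i of 0 \<Rightarrow> 0 | Suc j \<Rightarrow> x j"
  by (subst summable_Suc_iff[symmetric]) simp

lemma norm_right_shift: "norm (right_shift x) = norm x"
proof -
  let ?f = "\<lambda>i. (cmod (ell2_nth (right_shift x) i))\<^sup>2"
  have "(\<Sum>i. ?f (Suc i)) = (\<Sum>i. ?f i) - ?f 0"
    by (rule suminf_split_head[OF summable_ell2])
  then show ?thesis by (simp add: norm_ell2_def right_shift.rep_eq)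
qed

lift_definition scaled_shift :: "real \<Rightarrow> ell2 \<Rightarrow>\<^sub>L ell2" is "\<lambda>r x. r *\<^sub>R right_shift x"
  subgoal for r
    by (rule bounded_linear_intro[where K = "\<bar>r\<bar>"])
       (auto intro!: ell2_eqI simp: right_shift.rep_eq plus_ell2.rep_eq scaleR_ell2.rep_eq
          algebra_simps norm_right_shift split: nat.split)
  done

lemma norm_scaled_shift_le: "0 \<le> r \<Longrightarrow> norm (scaled_shift r) \<le> r"
  by (rule norm_blinfun_bound) (simp_all add: scaled_shift.rep_eq norm_right_shift)

lemma scaled_shift_in_C_mat: "scaled_shift r \<in> C_mat \<infinity>"
proof -
  have "x = 0" if "\<forall>i. ell2_nth x i = 0" for x
    using that by (intro ell2_eqI) (simp add: zero_ell2.rep_eq)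
  then show ?thesis
    by (auto simp: C_mat_def C_vec_def blinfun.zero_right scaled_shift.rep_eq scaleR_ell2.rep_eq
        right_shift.rep_eq ell2_scaleC.rep_eq intro!: ell2_eqI split: nat.split)
qed

lemma ell2_nth_op_pow_scaled_shift:
  "ell2_nth (blinfun_apply (op_pow (scaled_shift r) k) x) i
     = (if i < k then 0 else of_real (r ^ k) * ell2_nth x (i - k))"
proof (induction k arbitrary: i)
  case (Suc k)
  then show ?case
    by (cases i) (auto simp: op_pow_apply scaled_shift.rep_eq scaleR_ell2.rep_eq right_shift.rep_eq
        scaleR_conv_of_real)
qed (simp add: op_pow_apply)

lemma summable_ell2_nth_geometric:
  assumes "0 \<le> q" "q < 1"
  shows "summable (\<lambda>j. cmod (ell2_nth x j) * q ^ j)"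
proof (rule summable_comparison_test')
  show "summable (\<lambda>j. norm x * q ^ j)" using assms by (intro summable_mult summable_geometric) simp
  show "norm (cmod (ell2_nth x j) * q ^ j) \<le> norm x * q ^ j" for j
    using assms ell2_nth_le_norm[of x j] by (simp add: norm_mult norm_power mult_right_mono)
qed

text \<open>
  For \<open>Z\<close> the shift multiplied by \<open>r\<close>, the vector \<open>Z\<^sup>k e\<^sub>j\<close> is \<open>r\<^sup>k e\<^sub>k\<^sub>+\<^sub>j\<close>.  So for all
  \<open>f\<close> at once \<open>y\<^sub>n = c\<^sub>n\<^sup>* r\<^sup>-\<^sup>n\<close> gives
  \<open>y\<^sup>* f(Z) e\<^sub>j = r\<^sup>-\<^sup>j \<Sum>\<^sub>i f\<^sub>i c\<^sub>j\<^sub>+\<^sub>i\<close>, and \<open>y\<close> is square summable since \<open>c\<^sub>n\<close> decays like \<open>\<rho>\<^sup>n\<close> with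
  \<open>\<rho> < r\<close>.
\<close>

lemma annihilator_of_moments:
  assumes \<rho>: "0 < \<rho>" "\<rho> < r" "r < 1" and c: "\<And>n. cmod (c n) \<le> C * \<rho> ^ n"
  obtains y where "\<And>f. f holomorphic_on unit_disk \<Longrightarrow>
    left_annihilates \<infinity> y f (scaled_shift r) \<longleftrightarrow> (\<forall>j. (\<Sum>i. taylor_coeff f i * c (j + i)) = 0)"
proof -
  have r: "0 < r" using \<rho> by simp
  have q: "0 \<le> \<rho> / r" "\<rho> / r < 1" using \<rho> by auto
  have nZ: "norm (scaled_shift r) < 1" using norm_scaled_shift_le[of r] r \<rho> by simp
  define y where "y = Abs_ell2 (\<lambda>n. cnj (c n) / of_real (r ^ n))"
  have "summable (\<lambda>n. (cmod (cnj (c n) / of_real (r ^ n)))\<^sup>2)"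
  proof (rule summable_comparison_test')
    have "(\<rho> / r)\<^sup>2 < 1" using q by (simp add: power_less_one_iff abs_square_less_1)
    then show "summable (\<lambda>n. C\<^sup>2 * ((\<rho> / r)\<^sup>2) ^ n)"
      by (intro summable_mult summable_geometric) simp
    fix n
    have "cmod (cnj (c n) / of_real (r ^ n)) \<le> C * (\<rho> / r) ^ n"
      using divide_right_mono[OF c[of n], of "r ^ n"] r
      by (simp add: norm_divide norm_power power_divide)
    from power_mono[OF this norm_ge_zero, of 2]
    show "norm ((cmod (cnj (c n) / of_real (r ^ n)))\<^sup>2) \<le> C\<^sup>2 * ((\<rho> / r)\<^sup>2) ^ n"
      by (simp add: power_mult_distrib power_mult[symmetric] mult.commute)
  qed
  then have y: "ell2_nth y n = cnj (c n) / of_real (r ^ n)" for n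
    by (simp add: y_def Abs_ell2_inverse)
  define b where "b x j = ell2_nth x j / of_real (r ^ j)" for x j
  have pair: "ell2_cinner y (blinfun_apply (op_pow (scaled_shift r) k) x) = (\<Sum>j. b x j * c (k + j))" for x k
  proof -
    let ?u = "\<lambda>i. cnj (ell2_nth y i) * ell2_nth (blinfun_apply (op_pow (scaled_shift r) k) x) i"
    have "(\<Sum>i. ?u i) = (\<Sum>j. ?u (j + k))"
    proof -
      have s: "summable ?u"
        using summable_cmod_mult[OF summable_ell2[of y] summable_ell2]
        by (intro summable_norm_cancel[where f = ?u]) (simp add: norm_mult)
      show ?thesis
        unfolding suminf_split_initial_segment[OF s, of k] by (simp add: ell2_nth_op_pow_scaled_shift)
    qed
    also have "(\<lambda>j. ?u (j + k)) = (\<lambda>j. b x j * c (k + j))"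
      using r by (simp add: fun_eq_iff ell2_nth_op_pow_scaled_shift y b_def power_add field_simps)
    finally show ?thesis by (simp add: ell2_cinner_def)
  qed
  have sb: "summable (\<lambda>j. cmod (b x j) * \<rho> ^ j)" for x
    using summable_ell2_nth_geometric[OF q, of x] r
    by (simp add: b_def norm_divide norm_power power_divide)
  have "left_annihilates \<infinity> y f (scaled_shift r) \<longleftrightarrow> (\<forall>j. (\<Sum>i. taylor_coeff f i * c (j + i)) = 0)"
    if f: "f holomorphic_on unit_disk" for f
  proof
    have sf: "summable (\<lambda>k. cmod (taylor_coeff f k) * \<rho> ^ k)" using taylor_summable[OF f] \<rho> by simp
    {
      assume "\<forall>j. (\<Sum>i. taylor_coeff f i * c (j + i)) = 0"
      then have 0: "(\<lambda>k. (\<Sum>i\<le>k. taylor_coeff f i * b x (k - i)) * c k) sums 0" for x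
        using sums_Cauchy_product_weighted[OF sf sb c, of x] \<rho> by simp
      \<comment> \<open>The same antidiagonal sums arise with the roles of \<open>f\<close> and \<open>x\<close> exchanged.\<close>
      have "(\<Sum>k. taylor_coeff f k * (\<Sum>j. b x j * c (k + j))) = 0" for x
      proof -
        have "(\<Sum>i\<le>k. b x i * taylor_coeff f (k - i)) = (\<Sum>i\<le>k. taylor_coeff f i * b x (k - i))" for k
          by (rule sum.reindex_bij_witness[of _ "\<lambda>i. k - i" "\<lambda>i. k - i"]) auto
        then show ?thesis
          using sums_Cauchy_product_weighted[OF sb sf c, of x] 0[of x] \<rho> sums_unique2 by simp
      qed
      then show "left_annihilates \<infinity> y f (scaled_shift r)"
        by (simp add: left_annihilates_iff[OF f nZ] pair)
    next
      assume "left_annihilates \<infinity> y f (scaled_shift r)"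
      then have 0: "(\<Sum>k. taylor_coeff f k * (\<Sum>j. b x j * c (k + j))) = 0" for x
        by (simp add: left_annihilates_iff[OF f nZ] pair C_vec_def)
      show "\<forall>j. (\<Sum>i. taylor_coeff f i * c (j + i)) = 0"
      proof
        fix j
        \<comment> \<open>The factor \<open>r\<^sup>j\<close> cancels the weight of the \<open>j\<close>-th entry of \<open>y\<close>.\<close>
        define x where "x = Abs_ell2 (\<lambda>i. if i = j then of_real (r ^ j) else 0)"
        have "summable (\<lambda>i. (cmod (if i = j then of_real (r ^ j) else 0))\<^sup>2)"
          by (rule summable_finite[of "{j}"]) auto
        then have "ell2_nth x i = (if i = j then of_real (r ^ j) else 0)" for i
          by (simp add: x_def Abs_ell2_inverse)
        then have "b x i = (if i = j then 1 else 0)" for i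
          using r by (simp add: b_def)
        then have "(\<Sum>i. b x i * c (k + i)) = c (k + j)" for k
          using suminf_finite[of "{j}" "\<lambda>i. b x i * c (k + i)"] by simp
        with 0[of x] show "(\<Sum>i. taylor_coeff f i * c (j + i)) = 0" by (simp add: add.commute)
      qed
    }
  qed
  then show ?thesis using that by blast
qed

text \<open>
  The annihilator is built from \<open>c\<^sub>n = \<integral> z\<^sup>n / h(z) dz\<close>.  Then \<open>\<Sum>\<^sub>i f\<^sub>i c\<^sub>j\<^sub>+\<^sub>i\<close> is the integral of
  \<open>f(z) z\<^sup>j / h(z)\<close>, which vanishes for \<open>f = h\<close> by Cauchy's theorem.
\<close>

theorem quotient_hol_if_Sing_subset:
  assumes h: "h holomorphic_on unit_disk" and nz: "\<exists>z\<in>unit_disk. h z \<noteq> 0"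
    and g: "g holomorphic_on unit_disk" and sub: "Sing h \<subseteq> Sing g"
  shows "quotient_hol g h"
proof (rule quotient_hol_exhaust[OF h nz])
  fix r :: real assume "r < 1"
  from exists_zero_free_circle[OF h nz this] obtain \<rho> where \<rho>: "r < \<rho>" "0 < \<rho>" "\<rho> < 1"
    and nzc: "\<And>z. cmod z = \<rho> \<Longrightarrow> h z \<noteq> 0" by blast
  obtain r' where r': "\<rho> < r'" "r' < 1" using dense[OF \<rho>(3)] by blast
  let ?I = "contour_integral (circlepath 0 \<rho>)"
  define c where "c n = ?I (\<lambda>z. 1 / h z * z ^ n)" for n
  have sph: "sphere 0 \<rho> \<subseteq> unit_disk" using \<rho> by auto
  have cont: "continuous_on (sphere 0 \<rho>) (\<lambda>z. 1 / h z)"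
    using nzc continuous_on_subset[OF holomorphic_on_imp_continuous_on[OF h] sph]
    by (intro continuous_intros) auto
  have cont': "continuous_on (sphere 0 \<rho>) (\<lambda>z. 1 / h z * z ^ n)" for n
    by (intro continuous_on_mult cont continuous_intros)
  have "bounded ((\<lambda>z. 1 / h z) ` sphere 0 \<rho>)"
    by (rule compact_imp_bounded[OF compact_continuous_image[OF cont compact_sphere]])
  then obtain M where "\<forall>w\<in>(\<lambda>z. 1 / h z) ` sphere 0 \<rho>. cmod w \<le> M" unfolding bounded_iff ..
  then have M: "cmod (1 / h z) \<le> M" if "z \<in> sphere 0 \<rho>" for z
    using imageI[OF that, of "\<lambda>z. 1 / h z"] by (rule bspec)
  have "0 \<le> M" using M[of "of_real \<rho>"] \<rho> norm_ge_zero[of "1 / h (of_real \<rho>)"]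
    by (simp del: norm_ge_zero zero_le_divide_1_iff)
  have bound: "cmod (c n) \<le> (M * (2 * pi * \<rho>)) * \<rho> ^ n" for n
  proof -
    have "cmod (c n) \<le> (M * \<rho> ^ n) * (2 * pi * \<rho>)"
      unfolding c_def
    proof (rule has_contour_integral_bound_circlepath[OF has_contour_integral_integral])
      show "(\<lambda>z. 1 / h z * z ^ n) contour_integrable_on circlepath 0 \<rho>"
        using \<rho> by (intro contour_integrable_circlepath_if_continuous cont') simp
      fix z :: complex assume "cmod (z - 0) = \<rho>"
      then show "cmod (1 / h z * z ^ n) \<le> M * \<rho> ^ n"
        using mult_right_mono[OF M[of z], of "\<rho> ^ n"] \<rho> by (simp add: norm_mult norm_power norm_divide)
    qed (use \<rho> \<open>0 \<le> M\<close> in auto)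
    then show ?thesis by (simp add: mult_ac)
  qed
  obtain y where y: "\<And>f. f holomorphic_on unit_disk \<Longrightarrow>
    left_annihilates \<infinity> y f (scaled_shift r') \<longleftrightarrow> (\<forall>j. (\<Sum>i. taylor_coeff f i * c (j + i)) = 0)"
    using annihilator_of_moments[OF \<rho>(2) r' bound] by blast
  have mom: "(\<Sum>i. taylor_coeff f i * c (j + i)) = ?I (\<lambda>z. f z / h z * z ^ j)"
    if f: "f holomorphic_on unit_disk" for f j
    using sums_unique[OF contour_moments_sums[OF \<rho>(2,3) cont' f, of j]]
    by (simp add: c_def power_add mult_ac)
  have "?I (\<lambda>z. h z / h z * z ^ j) = 0" for j
  proof -
    have "?I (\<lambda>z. h z / h z * z ^ j) = ?I (\<lambda>z. z ^ j)"
      by (rule contour_integral_eq) (use nzc \<rho> in auto)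
    also have "\<dots> = 0"
      by (rule contour_integral_unique[OF Cauchy_theorem_convex_simple[of _ UNIV]])
         (auto intro!: holomorphic_intros)
    finally show ?thesis .
  qed
  then have "left_annihilates \<infinity> y h (scaled_shift r')" by (simp add: y[OF h] mom[OF h])
  moreover have "norm (scaled_shift r') < 1"
    using norm_scaled_shift_le[of r'] r' \<rho> by simp
  ultimately have "(\<infinity>, scaled_shift r', y) \<in> Sing h"
    by (simp add: Sing_def scaled_shift_in_C_mat C_vec_def)
  with sub have "(\<infinity>, scaled_shift r', y) \<in> Sing g" by blast
  then have "left_annihilates \<infinity> y g (scaled_shift r')" by (simp add: Sing_def)
  then have "?I (\<lambda>z. g z / h z * z ^ j) = 0" for j by (simp add: y[OF g] mom[OF g])
  from dvd_on_disk_if_moments_vanish[OF \<rho>(2,3) h g nzc this] \<rho>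
  show "\<exists>\<rho>>r. \<rho> < 1 \<and> (\<exists>k. k holomorphic_on ball 0 \<rho> \<and> (\<forall>z\<in>ball 0 \<rho>. g z = h z * k z))"
    by blast
qed

section \<open>Mean squares on circles\<close>

lemma has_integral_cis_int:
  "((\<lambda>t. cis (of_int m * t)) has_integral (if m = 0 then of_real (2 * pi) else 0)) {0..2 * pi}"
proof (cases "m = 0")
  case True
  then show ?thesis using has_integral_const_real[of "1::complex" 0 "2 * pi"]
    by (simp add: scaleR_conv_of_real)
next
  case False
  let ?a = "\<lambda>t::real. cis (of_int m * t) / (\<i> * of_int m)"
  have "((\<lambda>t. cis (of_int m * t)) has_integral (?a (2 * pi) - ?a 0)) {0..2 * pi}"
  proof (rule fundamental_theorem_of_calculus)
    fix t :: real
    have "((\<lambda>z. exp (\<i> * of_int m * z) / (\<i> * of_int m)) has_field_derivative exp (\<i> * of_int m * of_real t))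
        (at (of_real t))"
      using False by (auto intro!: derivative_eq_intros)
    then show "(?a has_vector_derivative cis (of_int m * t)) (at t within {0..2 * pi})"
      unfolding cis_conv_exp using has_vector_derivative_real_field by (fastforce simp: mult_ac)
  qed simp
  moreover have "cis (of_int m * (2 * pi)) = 1"
    using cis_multiple_2pi[of "of_int m"] by (simp add: mult_ac)
  ultimately show ?thesis using False by simp
qed

text \<open>
  Orthogonality of the characters \<open>cis (k t)\<close>.
\<close>

lemma has_integral_trig_poly_square:
  "((\<lambda>t. (cmod (\<Sum>k<N. a k * cis (real k * t)))\<^sup>2) has_integral 2 * pi * (\<Sum>k<N. (cmod (a k))\<^sup>2)) {0..2 * pi}"
proof -
  let ?g = "\<lambda>k l t. a k * cnj (a l) * cis (of_int (int k - int l) * t)"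
  let ?v = "\<lambda>k l. a k * cnj (a l) * (if int k - int l = 0 then of_real (2 * pi) else 0)"
  have "((\<lambda>t. \<Sum>k<N. \<Sum>l<N. ?g k l t) has_integral (\<Sum>k<N. \<Sum>l<N. ?v k l)) {0..2 * pi}"
    by (intro has_integral_sum has_integral_mult_right has_integral_cis_int) auto
  also have "(\<Sum>k<N. \<Sum>l<N. ?v k l) = of_real (2 * pi * (\<Sum>k<N. (cmod (a k))\<^sup>2))"
  proof -
    have "(\<Sum>l<N. ?v k l) = of_real (2 * pi * (cmod (a k))\<^sup>2)" if "k < N" for k
    proof -
      have "(\<Sum>l<N. ?v k l) = (\<Sum>l<N. if l = k then a k * cnj (a k) * of_real (2 * pi) else 0)"
        by (intro sum.cong) auto
      then show ?thesis using that by (simp add: complex_norm_square[symmetric] mult_ac)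
    qed
    then show ?thesis by (simp add: sum_distrib_left)
  qed
  also have "(\<lambda>t. \<Sum>k<N. \<Sum>l<N. ?g k l t) = (\<lambda>t. of_real ((cmod (\<Sum>k<N. a k * cis (real k * t)))\<^sup>2))"
  proof
    fix t
    have "?g k l t = (a k * cis (real k * t)) * cnj (a l * cis (real l * t))" for k l
      by (simp add: cis_cnj cis_mult left_diff_distrib)
    then show "(\<Sum>k<N. \<Sum>l<N. ?g k l t) = of_real ((cmod (\<Sum>k<N. a k * cis (real k * t)))\<^sup>2)"
      by (simp only: complex_norm_square sum_product cnj_sum)
  qed
  finally have "((\<lambda>t. of_real ((cmod (\<Sum>k<N. a k * cis (real k * t)))\<^sup>2)) has_integral
      complex_of_real (2 * pi * (\<Sum>k<N. (cmod (a k))\<^sup>2))) {0..2 * pi}" .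
  from has_integral_Re[OF this] show ?thesis by (simp only: Re_complex_of_real)
qed

definition circle_mean :: "(complex \<Rightarrow> complex) \<Rightarrow> real \<Rightarrow> real" where
  "circle_mean F r = integral {0..2 * pi} (\<lambda>t. (cmod (F (of_real r * cis t)))\<^sup>2) / (2 * pi)"

lemma continuous_on_circle:
  assumes "F holomorphic_on unit_disk" "0 \<le> r" "r < 1"
  shows "continuous_on A (\<lambda>t. F (of_real r * cis t))"
  by (rule continuous_on_compose2[OF holomorphic_on_imp_continuous_on[OF assms(1)]])
     (use assms in \<open>auto intro!: continuous_intros simp: norm_mult\<close>)

lemma circle_mean_poly: "circle_mean (\<lambda>z. \<Sum>k<N. a k * z ^ k) 1 = (\<Sum>k<N. (cmod (a k))\<^sup>2)"
  using integral_unique[OF has_integral_trig_poly_square[of a N]]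
  unfolding circle_mean_def of_real_1 mult_1 Complex.DeMoivre by simp

lemma circle_mean_sums:
  assumes F: "F holomorphic_on unit_disk" and r: "0 \<le> r" "r < 1"
  shows "(\<lambda>k. (cmod (taylor_coeff F k) * r ^ k)\<^sup>2) sums circle_mean F r"
proof -
  define a where "a k = taylor_coeff F k * of_real r ^ k" for k
  have sa: "summable (\<lambda>k. cmod (a k))"
    using taylor_summable[OF F r] r by (simp add: a_def norm_mult norm_power)
  let ?P = "\<lambda>N t. (cmod (\<Sum>k<N. a k * cis (real k * t)))\<^sup>2"
  have "(\<lambda>N. integral {0..2 * pi} (?P N)) \<longlonglongrightarrow> integral {0..2 * pi} (\<lambda>t. (cmod (F (of_real r * cis t)))\<^sup>2)"
  proof (rule dominated_convergence(2))
    show "?P N integrable_on {0..2 * pi}" for N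
      using has_integral_trig_poly_square by blast
    show "(\<lambda>t::real. (\<Sum>k. cmod (a k))\<^sup>2) integrable_on {0..2 * pi}" by (rule integrable_const_ivl)
    fix t :: real
    show "(\<lambda>N. ?P N t) \<longlonglongrightarrow> (cmod (F (of_real r * cis t)))\<^sup>2"
    proof (intro tendsto_intros)
      have "(\<lambda>k. taylor_coeff F k * (of_real r * cis t) ^ k) sums F (of_real r * cis t)"
        using r by (intro taylor_sums[OF F]) (simp add: norm_mult)
      then show "(\<lambda>N. \<Sum>k<N. a k * cis (real k * t)) \<longlonglongrightarrow> F (of_real r * cis t)"
        unfolding sums_def a_def power_mult_distrib Complex.DeMoivre by (simp only: mult.assoc)
    qed
    fix N
    have "cmod (\<Sum>k<N. a k * cis (real k * t)) \<le> (\<Sum>k<N. cmod (a k))"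
      by (rule order_trans[OF norm_sum]) (simp add: norm_mult)
    also have "\<dots> \<le> (\<Sum>k. cmod (a k))" by (rule sum_le_suminf[OF sa]) auto
    finally show "norm (?P N t) \<le> (\<Sum>k. cmod (a k))\<^sup>2" by (simp add: power_mono)
  qed
  then have "(\<lambda>N. integral {0..2 * pi} (?P N) / (2 * pi)) \<longlonglongrightarrow> circle_mean F r"
    unfolding circle_mean_def by (intro tendsto_intros) auto
  moreover have "integral {0..2 * pi} (?P N) / (2 * pi) = (\<Sum>k<N. (cmod (taylor_coeff F k) * r ^ k)\<^sup>2)" for N
    using integral_unique[OF has_integral_trig_poly_square[of a N]] r
    by (simp add: a_def norm_mult norm_power)
  ultimately show ?thesis by (simp add: sums_def)
qed

text \<open>
  Radii tending to \<open>1\<close> along a sequence, as dominated convergence asks for.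
\<close>

definition rad :: "nat \<Rightarrow> real" where "rad n = 1 - inverse (real (Suc n))"

lemma rad: "0 \<le> rad n" "rad n < 1"
  by (simp_all add: rad_def field_simps)

lemma rad_tendsto: "rad \<longlonglongrightarrow> 1"
  using tendsto_diff[OF tendsto_const[of 1] LIMSEQ_inverse_real_of_nat] by (simp add: rad_def[abs_def])

lemma H2_norm_sq: "f \<in> H2 \<Longrightarrow> (H2_norm f)\<^sup>2 = (\<Sum>k. (cmod (taylor_coeff f k))\<^sup>2)"
  by (simp add: H2_norm_def H2_def suminf_nonneg)

lemma H2_norm_nonneg: "f \<in> H2 \<Longrightarrow> 0 \<le> H2_norm f"
  by (simp add: H2_norm_def H2_def suminf_nonneg)

text \<open>
  Each partial sum of the squared coefficients is the limit of its dilated version, which is bounded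
  by the circle mean.  The varying bound \<open>u n\<close> covers both uses: a constant bound, and the circle means
  themselves when they converge.
\<close>

lemma H2_if_circle_mean_le:
  assumes F: "F holomorphic_on unit_disk"
    and le: "\<And>n. circle_mean F (rad n) \<le> u n" and u: "u \<longlonglongrightarrow> L"
  shows "F \<in> H2" and "(H2_norm F)\<^sup>2 \<le> L"
proof -
  have part: "(\<Sum>k<N. (cmod (taylor_coeff F k))\<^sup>2) \<le> L" for N
  proof (rule LIMSEQ_le[OF _ u])
    have "(\<lambda>n. \<Sum>k<N. (cmod (taylor_coeff F k) * rad n ^ k)\<^sup>2) \<longlonglongrightarrow> (\<Sum>k<N. (cmod (taylor_coeff F k) * 1 ^ k)\<^sup>2)"
      by (intro tendsto_intros rad_tendsto)
    then show "(\<lambda>n. \<Sum>k<N. (cmod (taylor_coeff F k) * rad n ^ k)\<^sup>2) \<longlonglongrightarrow> (\<Sum>k<N. (cmod (taylor_coeff F k))\<^sup>2)"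
      by simp
    have "(\<Sum>k<N. (cmod (taylor_coeff F k) * rad n ^ k)\<^sup>2) \<le> circle_mean F (rad n)" for n
      unfolding sums_unique[OF circle_mean_sums[OF F rad]]
      by (rule sum_le_suminf[OF sums_summable[OF circle_mean_sums[OF F rad]]]) auto
    then show "\<exists>n0. \<forall>n\<ge>n0. (\<Sum>k<N. (cmod (taylor_coeff F k) * rad n ^ k)\<^sup>2) \<le> u n"
      using le order_trans by blast
  qed
  have sm: "summable (\<lambda>k. (cmod (taylor_coeff F k))\<^sup>2)"
    by (rule bounded_imp_summable[where B = L]) (use part[of "Suc _"] in \<open>simp_all add: lessThan_Suc_atMost\<close>)
  with F show "F \<in> H2" by (simp add: H2_def)
  then show "(H2_norm F)\<^sup>2 \<le> L"
    by (simp add: H2_norm_sq) (rule suminf_le_const[OF sm part])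
qed

lemma circle_mean_le_H2_norm:
  assumes "F \<in> H2" "0 \<le> r" "r < 1"
  shows "circle_mean F r \<le> (H2_norm F)\<^sup>2"
proof -
  have F: "F holomorphic_on unit_disk" "summable (\<lambda>k. (cmod (taylor_coeff F k))\<^sup>2)"
    using assms by (auto simp: H2_def)
  have s: "(\<lambda>k. (cmod (taylor_coeff F k) * r ^ k)\<^sup>2) sums circle_mean F r"
    by (rule circle_mean_sums[OF F(1) assms(2,3)])
  show ?thesis
    unfolding H2_norm_sq[OF assms(1)] sums_unique[OF s]
  proof (rule suminf_le[OF _ sums_summable[OF s] F(2)])
    fix k
    have "cmod (taylor_coeff F k) * r ^ k \<le> cmod (taylor_coeff F k) * 1"
      using assms by (intro mult_left_mono power_le_one) auto
    then show "(cmod (taylor_coeff F k) * r ^ k)\<^sup>2 \<le> (cmod (taylor_coeff F k))\<^sup>2"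
      using assms by (intro power_mono) auto
  qed
qed

text \<open>
  The circle means of \<open>\<theta> k\<close> and \<open>k\<close> compare pointwise, and determine the norms in the limit.
\<close>

lemma H2_mult_bounded:
  assumes \<theta>: "\<theta> holomorphic_on unit_disk" and M: "\<And>z. cmod z < 1 \<Longrightarrow> cmod (\<theta> z) \<le> M"
    and k: "k \<in> H2"
  shows "(\<lambda>z. \<theta> z * k z) \<in> H2" and "H2_norm (\<lambda>z. \<theta> z * k z) \<le> M * H2_norm k"
proof -
  have M0: "0 \<le> M" using order_trans[OF norm_ge_zero M[of 0]] by simp
  have holk: "k holomorphic_on unit_disk" using k by (simp add: H2_def)
  have hol: "(\<lambda>z. \<theta> z * k z) holomorphic_on unit_disk" by (intro holomorphic_intros \<theta> holk)
  have le: "circle_mean (\<lambda>z. \<theta> z * k z) (rad n) \<le> M\<^sup>2 * (H2_norm k)\<^sup>2" for n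
  proof -
    have "integral {0..2 * pi} (\<lambda>t. (cmod (\<theta> (of_real (rad n) * cis t) * k (of_real (rad n) * cis t)))\<^sup>2)
        \<le> integral {0..2 * pi} (\<lambda>t. M\<^sup>2 * (cmod (k (of_real (rad n) * cis t)))\<^sup>2)"
    proof (rule integral_le)
      show "(\<lambda>t. (cmod (\<theta> (of_real (rad n) * cis t) * k (of_real (rad n) * cis t)))\<^sup>2) integrable_on {0..2 * pi}"
        by (intro integrable_continuous_real continuous_intros continuous_on_circle \<theta> holk rad)
      show "(\<lambda>t. M\<^sup>2 * (cmod (k (of_real (rad n) * cis t)))\<^sup>2) integrable_on {0..2 * pi}"
        by (intro integrable_continuous_real continuous_intros continuous_on_circle holk rad)
      show "(cmod (\<theta> (of_real (rad n) * cis t) * k (of_real (rad n) * cis t)))\<^sup>2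
          \<le> M\<^sup>2 * (cmod (k (of_real (rad n) * cis t)))\<^sup>2" for t
        unfolding norm_mult power_mult_distrib
        using rad[of n] by (intro mult_right_mono power_mono M) (auto simp: norm_mult)
    qed
    then have "circle_mean (\<lambda>z. \<theta> z * k z) (rad n) \<le> M\<^sup>2 * circle_mean k (rad n)"
      by (simp add: circle_mean_def divide_right_mono)
    also have "\<dots> \<le> M\<^sup>2 * (H2_norm k)\<^sup>2"
      by (intro mult_left_mono circle_mean_le_H2_norm k rad) simp
    finally show ?thesis .
  qed
  show "(\<lambda>z. \<theta> z * k z) \<in> H2" by (rule H2_if_circle_mean_le[OF hol le tendsto_const])
  have "(H2_norm (\<lambda>z. \<theta> z * k z))\<^sup>2 \<le> (M * H2_norm k)\<^sup>2"
    using H2_if_circle_mean_le(2)[OF hol le tendsto_const] by (simp add: power_mult_distrib)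
  then show "H2_norm (\<lambda>z. \<theta> z * k z) \<le> M * H2_norm k"
    by (rule power2_le_imp_le[OF _ mult_nonneg_nonneg[OF M0 H2_norm_nonneg[OF k]]])
qed

lemma Hinf_boundE:
  assumes "f \<in> Hinf"
  obtains M where "\<And>z. cmod z < 1 \<Longrightarrow> cmod (f z) \<le> M"
proof -
  have "bounded (f ` unit_disk)" using assms by (simp add: Hinf_def)
  then obtain M where "\<forall>w\<in>f ` unit_disk. cmod w \<le> M" unfolding bounded_iff ..
  then have "cmod (f z) \<le> M" if "cmod z < 1" for z using that by auto
  then show ?thesis using that by blast
qed

text \<open>
  The only place where the boundary values of an inner function enter: dominated convergence for
  \<open>|\<theta> p|\<^sup>2\<close>, which is bounded and tends to \<open>|p|\<^sup>2\<close> almost everywhere on the circle.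
\<close>

lemma circle_mean_inner_mult_tendsto:
  assumes \<theta>: "inner_fun \<theta>" and p: "p holomorphic_on UNIV"
  shows "(\<lambda>n. circle_mean (\<lambda>z. \<theta> z * p z) (rad n)) \<longlonglongrightarrow> circle_mean p 1"
proof -
  have hol: "\<theta> holomorphic_on unit_disk" using \<theta> by (simp add: inner_fun_def Hinf_def)
  obtain M where M: "\<And>z. cmod z < 1 \<Longrightarrow> cmod (\<theta> z) \<le> M"
    using Hinf_boundE[of \<theta>] \<theta> unfolding inner_fun_def by blast
  have contp: "continuous_on A p" for A
    using holomorphic_on_imp_continuous_on[OF p] continuous_on_subset by blast
  have "bounded (p ` cball 0 1)"
    by (rule compact_imp_bounded[OF compact_continuous_image[OF contp compact_cball]])
  then obtain P where "\<forall>w\<in>p ` cball 0 1. cmod w \<le> P" unfolding bounded_iff ..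
  then have P: "cmod (p z) \<le> P" if "cmod z \<le> 1" for z using that by auto
  let ?I = "{0..2 * pi}"
  let ?f = "\<lambda>n t. (cmod (\<theta> (of_real (rad n) * cis t) * p (of_real (rad n) * cis t)))\<^sup>2"
  let ?g = "\<lambda>t. (cmod (p (of_real 1 * cis t)))\<^sup>2"
  have contf: "continuous_on ?I (?f n)" for n
    by (intro continuous_intros continuous_on_circle hol rad holomorphic_on_subset[OF p]) auto
  have contg: "continuous_on ?I ?g"
    by (intro continuous_intros continuous_on_compose2[OF contp[of UNIV]]) auto
  have ae: "AE t in lebesgue_on ?I. (\<lambda>n. ?f n t) \<longlonglongrightarrow> ?g t"
    using \<theta> unfolding inner_fun_def
  proof (elim conjE eventually_mono)
    fix t assume "\<exists>w. cmod w = 1 \<and> ((\<lambda>r. \<theta> (of_real r * cis t)) \<longlongrightarrow> w) (at_left 1)"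
    then obtain w where w: "cmod w = 1" "((\<lambda>r. \<theta> (of_real r * cis t)) \<longlongrightarrow> w) (at_left 1)" by blast
    have "filterlim rad (at_left 1) sequentially"
      by (rule tendsto_imp_filterlim_at_left[OF rad_tendsto]) (simp add: rad)
    then have 1: "(\<lambda>n. \<theta> (of_real (rad n) * cis t)) \<longlonglongrightarrow> w"
      by (rule filterlim_compose[OF w(2)])
    have "isCont p (of_real 1 * cis t)" using contp[of UNIV] by (simp add: continuous_on_eq_continuous_at)
    then have 2: "(\<lambda>n. p (of_real (rad n) * cis t)) \<longlonglongrightarrow> p (of_real 1 * cis t)"
      by (rule isCont_tendsto_compose) (intro tendsto_intros rad_tendsto)
    have "(\<lambda>n. ?f n t) \<longlonglongrightarrow> (cmod (w * p (of_real 1 * cis t)))\<^sup>2"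
      by (intro tendsto_intros 1 2)
    then show "(\<lambda>n. ?f n t) \<longlonglongrightarrow> ?g t" by (simp add: norm_mult w)
  qed
  have leb: "integral\<^sup>L (lebesgue_on ?I) u = integral ?I u" if "continuous_on ?I u" for u :: "real \<Rightarrow> real"
    by (rule lebesgue_integral_eq_integral) (auto intro: integrable_continuous_real continuous_imp_integrable_real that)
  have meas: "u \<in> borel_measurable (lebesgue_on ?I)" if "continuous_on ?I u" for u :: "real \<Rightarrow> real"
    by (rule continuous_imp_measurable_on_sets_lebesgue[OF that]) simp
  have "(\<lambda>n. integral\<^sup>L (lebesgue_on ?I) (?f n)) \<longlonglongrightarrow> integral\<^sup>L (lebesgue_on ?I) ?g"
  proof (rule integral_dominated_convergence[where w = "\<lambda>_. (M * P)\<^sup>2"])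
    show "AE t in lebesgue_on ?I. norm (?f n t) \<le> (M * P)\<^sup>2" for n
    proof (rule AE_I2)
      fix t
      have "cmod (\<theta> (of_real (rad n) * cis t) * p (of_real (rad n) * cis t)) \<le> M * P"
        unfolding norm_mult using rad[of n] order_trans[OF norm_ge_zero M[of 0]]
        by (intro mult_mono M P) (auto simp: norm_mult)
      then show "norm (?f n t) \<le> (M * P)\<^sup>2" by (simp add: power_mono)
    qed
    show "integrable (lebesgue_on ?I) (\<lambda>_. (M * P)\<^sup>2)"
      by (rule continuous_imp_integrable_real) simp
  qed (rule meas contf contg ae)+
  then have "(\<lambda>n. integral ?I (?f n)) \<longlonglongrightarrow> integral ?I ?g"
    by (simp only: leb contf contg)
  then show ?thesis unfolding circle_mean_def by (intro tendsto_intros) auto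
qed

section \<open>The Hilbert space of the Hardy class\<close>

lemma H2_hol: "f \<in> H2 \<Longrightarrow> f holomorphic_on unit_disk"
  by (simp add: H2_def)

lemma Hinf_hol: "f \<in> Hinf \<Longrightarrow> f holomorphic_on unit_disk"
  by (simp add: Hinf_def)

text \<open>
  The identification of \<open>H\<^sup>2\<close> with \<open>\<ell>\<^sup>2\<close>, through which \<open>H\<^sup>2\<close> obtains the triangle inequality and
  completeness.
\<close>

definition H2_vec :: "(complex \<Rightarrow> complex) \<Rightarrow> ell2" where
  "H2_vec f = Abs_ell2 (taylor_coeff f)"

lemma ell2_nth_H2_vec: "f \<in> H2 \<Longrightarrow> ell2_nth (H2_vec f) = taylor_coeff f"
  by (simp add: H2_vec_def H2_def Abs_ell2_inverse)

lemma norm_H2_vec: "f \<in> H2 \<Longrightarrow> norm (H2_vec f) = H2_norm f"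
  by (simp add: norm_ell2_def H2_norm_def ell2_nth_H2_vec)

lemma H2_diff:
  assumes "f \<in> H2" "g \<in> H2"
  shows "(\<lambda>z. f z - g z) \<in> H2"
proof -
  have "summable (\<lambda>i. (cmod (taylor_coeff f i + - taylor_coeff g i))\<^sup>2)"
    by (rule summable_cmod_add_sq) (use assms in \<open>simp_all add: H2_def\<close>)
  then show ?thesis
    using assms by (auto simp: H2_def taylor_coeff_diff intro!: holomorphic_intros)
qed

lemma H2_vec_diff:
  assumes "f \<in> H2" "g \<in> H2"
  shows "H2_vec (\<lambda>z. f z - g z) = H2_vec f - H2_vec g"
  by (rule ell2_eqI)
     (simp add: ell2_nth_H2_vec H2_diff assms minus_ell2.rep_eq taylor_coeff_diff H2_hol)

lemma H2_norm_diff: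
  "f \<in> H2 \<Longrightarrow> g \<in> H2 \<Longrightarrow> H2_norm (\<lambda>z. f z - g z) = norm (H2_vec f - H2_vec g)"
  by (simp add: H2_vec_diff[symmetric] norm_H2_vec H2_diff)

lemma H2_vec_inject:
  assumes "f \<in> H2" "g \<in> H2" "H2_vec f = H2_vec g" "cmod z < 1"
  shows "f z = g z"
proof -
  have "taylor_coeff f = taylor_coeff g"
    using assms(3) by (simp add: ell2_nth_H2_vec[OF assms(1), symmetric] ell2_nth_H2_vec[OF assms(2), symmetric])
  with taylor_sums[OF H2_hol[OF assms(1)] assms(4)]
  have "(\<lambda>k. taylor_coeff g k * z ^ k) sums f z" by simp
  then show ?thesis by (rule sums_unique2[OF _ taylor_sums[OF H2_hol[OF assms(2)] assms(4)]])
qed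

lemma H2_vec_surj: obtains f where "f \<in> H2" "H2_vec f = x"
proof -
  let ?f = "\<lambda>z. \<Sum>k. ell2_nth x k * z ^ k"
  have s: "(\<lambda>k. ell2_nth x k * z ^ k) sums ?f z" if "cmod z < 1" for z
    using summable_ell2_nth_geometric[OF norm_ge_zero that, of x]
    by (intro summable_sums[OF summable_norm_cancel]) (simp add: norm_mult norm_power)
  have f: "?f \<in> H2" "taylor_coeff ?f = ell2_nth x"
    using taylor_coeff_unique[of "ell2_nth x" ?f, OF s] by (simp_all add: H2_def summable_ell2)
  then have "H2_vec ?f = x" by (simp add: H2_vec_def ell2_nth_inverse)
  with f(1) show ?thesis by (rule that)
qed

lemma cmod_taylor_coeff_le: "f \<in> H2 \<Longrightarrow> cmod (taylor_coeff f k) \<le> H2_norm f"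
  using ell2_nth_le_norm[of "H2_vec f" k] by (simp add: ell2_nth_H2_vec norm_H2_vec)

lemma taylor_coeff_0: "taylor_coeff f 0 = f 0"
  by (simp add: taylor_coeff_def)

lemma H2_point_bound:
  assumes f: "f \<in> H2" and z: "cmod z < 1"
  shows "cmod (f z) * (1 - cmod z) \<le> H2_norm f"
proof -
  have s: "summable (\<lambda>k. H2_norm f * cmod z ^ k)"
    using z by (intro summable_mult summable_geometric) simp
  have "cmod (f z) = cmod (\<Sum>k. taylor_coeff f k * z ^ k)"
    using sums_unique[OF taylor_sums[OF H2_hol[OF f] z]] by simp
  also have "\<dots> \<le> (\<Sum>k. H2_norm f * cmod z ^ k)"
    by (rule norm_suminf_le[OF _ s])
       (use cmod_taylor_coeff_le[OF f] in \<open>simp add: norm_mult norm_power mult_right_mono\<close>)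
  also have "\<dots> = H2_norm f / (1 - cmod z)"
    using z by (simp add: suminf_mult suminf_geometric summable_geometric divide_inverse)
  finally show ?thesis using z by (simp add: field_simps)
qed

lemma poly_bounded:
  obtains M where "\<And>z. cmod z < 1 \<Longrightarrow> cmod (poly q z) \<le> M"
proof -
  have "bounded (poly q ` cball 0 1)"
    by (intro compact_imp_bounded compact_continuous_image continuous_intros) auto
  then obtain M where "\<forall>w\<in>poly q ` cball 0 1. cmod w \<le> M" unfolding bounded_iff ..
  then have "cmod (poly q z) \<le> M" if "cmod z < 1" for z using that by auto
  then show ?thesis by (rule that)
qed

lemma H2_mult_poly: "f \<in> H2 \<Longrightarrow> (\<lambda>z. poly q z * f z) \<in> H2"
  by (rule poly_bounded[of q], rule H2_mult_bounded(1)) (auto intro!: holomorphic_intros)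

lemma H2_one: "(\<lambda>z. 1) \<in> H2"
proof -
  have "taylor_coeff (\<lambda>z. 1) = (\<lambda>k. if k = 0 then 1 else 0)"
  proof (rule taylor_coeff_unique(2))
    fix z :: complex
    show "(\<lambda>k. (if k = 0 then 1 else 0) * z ^ k) sums 1"
      using sums_If_finite_set[of "{0}" "\<lambda>k. z ^ k"] by (simp add: if_distrib[of "\<lambda>x. x * _"] cong: if_cong)
  qed
  then show ?thesis by (auto simp: H2_def intro!: summable_finite[of "{0}"] split: if_splits)
qed

lemma Hinf_subset_H2: "f \<in> Hinf \<Longrightarrow> f \<in> H2"
  by (rule Hinf_boundE, assumption, drule H2_mult_bounded(1)[OF Hinf_hol _ H2_one]) simp_all

lemma H2_cmult: "f \<in> H2 \<Longrightarrow> (\<lambda>z. c * f z) \<in> H2"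
  by (rule H2_mult_bounded(1)[of "\<lambda>_. c" "cmod c" f]) (auto intro: holomorphic_intros)

section \<open>Multiplication by inner functions\<close>

lemma H2_norm_poly_le_inner_mult:
  fixes a :: "nat \<Rightarrow> complex" and N :: nat
  assumes \<theta>: "inner_fun \<theta>"
  defines "p \<equiv> \<lambda>z. \<Sum>k<N. a k * z ^ k"
  shows "sqrt (\<Sum>k<N. (cmod (a k))\<^sup>2) \<le> H2_norm (\<lambda>z. \<theta> z * p z)"
proof -
  have hol: "p holomorphic_on UNIV" unfolding p_def by (intro holomorphic_intros)
  have lim: "(\<lambda>n. circle_mean (\<lambda>z. \<theta> z * p z) (rad n)) \<longlonglongrightarrow> (\<Sum>k<N. (cmod (a k))\<^sup>2)"
    using circle_mean_inner_mult_tendsto[OF \<theta> hol] circle_mean_poly[of a N] by (simp add: p_def)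
  have H: "(\<lambda>z. \<theta> z * p z) \<in> H2"
  proof (rule H2_if_circle_mean_le(1)[OF _ order_refl lim])
    show "(\<lambda>z. \<theta> z * p z) holomorphic_on unit_disk"
      using \<theta> by (intro holomorphic_intros holomorphic_on_subset[OF hol]) (auto simp: inner_fun_def Hinf_def)
  qed
  have "(\<Sum>k<N. (cmod (a k))\<^sup>2) \<le> (H2_norm (\<lambda>z. \<theta> z * p z))\<^sup>2"
    by (rule LIMSEQ_le_const2[OF lim]) (use circle_mean_le_H2_norm[OF H rad] in blast)
  then show ?thesis by (rule real_le_lsqrt[OF H2_norm_nonneg[OF H]])
qed

lemma H2_norm_inner_le_1:
  assumes \<theta>: "inner_fun \<theta>"
  shows "H2_norm \<theta> \<le> 1"
proof -
  have lim: "(\<lambda>n. circle_mean \<theta> (rad n)) \<longlonglongrightarrow> 1"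
    using circle_mean_inner_mult_tendsto[OF \<theta>, of "\<lambda>_. 1"] circle_mean_poly[of "\<lambda>_. 1" 1] by simp
  have "\<theta> holomorphic_on unit_disk" using \<theta> by (simp add: inner_fun_def Hinf_def)
  then have "(H2_norm \<theta>)\<^sup>2 \<le> 1" by (rule H2_if_circle_mean_le(2)[OF _ order_refl lim])
  then show ?thesis by (rule power2_le_imp_le[of _ 1, simplified])
qed

text \<open>
  Known for polynomials, and both sides are continuous in \<open>k\<close> because multiplication by the bounded
  function \<open>\<theta>\<close> is continuous.  The Taylor polynomials of \<open>k\<close> converge to \<open>k\<close>.
\<close>

lemma H2_norm_le_inner_mult:
  assumes \<theta>: "inner_fun \<theta>" and k: "k \<in> H2"
  shows "H2_norm k \<le> H2_norm (\<lambda>z. \<theta> z * k z)"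
proof -
  have hol\<theta>: "\<theta> holomorphic_on unit_disk" using \<theta> by (simp add: inner_fun_def Hinf_def)
  obtain M where M: "\<And>z. cmod z < 1 \<Longrightarrow> cmod (\<theta> z) \<le> M"
    using \<theta> Hinf_boundE[of \<theta>] unfolding inner_fun_def by blast
  let ?c = "taylor_coeff k"
  have sc: "summable (\<lambda>i. (cmod (?c i))\<^sup>2)" using k by (simp add: H2_def)
  define p where "p N z = (\<Sum>i<N. ?c i * z ^ i)" for N z
  have cp: "taylor_coeff (p N) = (\<lambda>i. if i < N then ?c i else 0)" "p N holomorphic_on unit_disk" for N
  proof -
    have "(\<lambda>i. (if i < N then ?c i else 0) * z ^ i) sums p N z" for z
      using sums_If_finite_set[of "{..<N}" "\<lambda>i. ?c i * z ^ i"]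
      by (simp add: p_def if_distrib[of "\<lambda>x. x * _"] cong: if_cong)
    from taylor_coeff_unique[OF this]
    show "taylor_coeff (p N) = (\<lambda>i. if i < N then ?c i else 0)" "p N holomorphic_on unit_disk" by auto
  qed
  have p: "p N \<in> H2" for N
    using cp by (simp add: H2_def) (rule summable_finite[of "{..<N}"], auto)
  define S where "S N = (\<Sum>i<N. (cmod (?c i))\<^sup>2)" for N
  have S: "S \<longlonglongrightarrow> (H2_norm k)\<^sup>2"
    unfolding H2_norm_sq[OF k] S_def by (rule summable_LIMSEQ[OF sc])
  have tail: "H2_norm (\<lambda>z. p N z - k z) = sqrt ((H2_norm k)\<^sup>2 - S N)" for N
  proof -
    have "(\<lambda>i. (cmod (?c i))\<^sup>2 - (if i \<in> {..<N} then (cmod (?c i))\<^sup>2 else 0)) sums ((H2_norm k)\<^sup>2 - S N)"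
      unfolding H2_norm_sq[OF k] S_def by (intro sums_diff summable_sums[OF sc] sums_If_finite_set) simp
    moreover have "(cmod (?c i))\<^sup>2 - (if i \<in> {..<N} then (cmod (?c i))\<^sup>2 else 0)
        = (cmod (taylor_coeff (\<lambda>z. p N z - k z) i))\<^sup>2" for i
      by (simp add: taylor_coeff_diff cp H2_hol[OF k])
    ultimately show ?thesis by (simp add: H2_norm_def sums_iff)
  qed
  have le: "sqrt (S N) \<le> H2_norm (\<lambda>z. \<theta> z * k z) + M * sqrt ((H2_norm k)\<^sup>2 - S N)" for N
  proof -
    have \<theta>p: "(\<lambda>z. \<theta> z * p N z) \<in> H2" and \<theta>k: "(\<lambda>z. \<theta> z * k z) \<in> H2"
      by (rule H2_mult_bounded(1)[OF hol\<theta> M]; simp add: p k)+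
    have "sqrt (S N) \<le> norm (H2_vec (\<lambda>z. \<theta> z * p N z))"
      using H2_norm_poly_le_inner_mult[OF \<theta>, where N = N and a = ?c]
      by (simp add: S_def p_def norm_H2_vec[OF \<theta>p, unfolded p_def])
    also have "\<dots> \<le> norm (H2_vec (\<lambda>z. \<theta> z * k z)) + norm (H2_vec (\<lambda>z. \<theta> z * p N z) - H2_vec (\<lambda>z. \<theta> z * k z))"
      by (rule norm_triangle_sub)
    also have "norm (H2_vec (\<lambda>z. \<theta> z * p N z) - H2_vec (\<lambda>z. \<theta> z * k z)) = H2_norm (\<lambda>z. \<theta> z * (p N z - k z))"
      by (simp add: H2_norm_diff[OF \<theta>p \<theta>k, symmetric] right_diff_distrib)
    also have "\<dots> \<le> M * H2_norm (\<lambda>z. p N z - k z)"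
      by (rule H2_mult_bounded(2)[OF hol\<theta> M]) (auto intro: H2_diff p k)
    finally show ?thesis by (simp add: tail norm_H2_vec[OF \<theta>k])
  qed
  have "H2_norm k \<le> H2_norm (\<lambda>z. \<theta> z * k z) + M * 0"
  proof (rule LIMSEQ_le)
    show "(\<lambda>N. sqrt (S N)) \<longlonglongrightarrow> H2_norm k"
      using tendsto_real_sqrt[OF S] H2_norm_nonneg[OF k] by simp
    have "(\<lambda>N. sqrt ((H2_norm k)\<^sup>2 - S N)) \<longlonglongrightarrow> sqrt ((H2_norm k)\<^sup>2 - (H2_norm k)\<^sup>2)"
      by (intro tendsto_intros S)
    then show "(\<lambda>N. H2_norm (\<lambda>z. \<theta> z * k z) + M * sqrt ((H2_norm k)\<^sup>2 - S N))
        \<longlonglongrightarrow> H2_norm (\<lambda>z. \<theta> z * k z) + M * 0"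
      by (intro tendsto_intros) simp
    show "\<exists>N. \<forall>n\<ge>N. sqrt (S n) \<le> H2_norm (\<lambda>z. \<theta> z * k z) + M * sqrt ((H2_norm k)\<^sup>2 - S n)"
      using le by blast
  qed
  then show ?thesis by simp
qed

text \<open>
  Since multiplication by \<open>\<theta>\<close> does not decrease distances, \<open>g\<^sub>n\<close> is a Cauchy sequence when
  \<open>\<theta> g\<^sub>n\<close> converges.
\<close>

lemma inner_range_closed:
  assumes \<theta>: "inner_fun \<theta>" and u: "u \<in> H2" and g: "\<And>n. g n \<in> H2"
    and lim: "(\<lambda>n. H2_norm (\<lambda>z. u z - \<theta> z * g n z)) \<longlonglongrightarrow> 0"
  shows "\<exists>k\<in>H2. \<forall>z\<in>unit_disk. u z = \<theta> z * k z"
proof -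
  have hol\<theta>: "\<theta> holomorphic_on unit_disk" using \<theta> by (simp add: inner_fun_def Hinf_def)
  obtain M where M: "\<And>z. cmod z < 1 \<Longrightarrow> cmod (\<theta> z) \<le> M"
    using \<theta> Hinf_boundE[of \<theta>] unfolding inner_fun_def by blast
  have \<theta>H2: "(\<lambda>z. \<theta> z * k z) \<in> H2" if "k \<in> H2" for k
    by (rule H2_mult_bounded(1)[OF hol\<theta> M that])
  define V where "V n = H2_vec (\<lambda>z. \<theta> z * g n z)" for n
  have "(\<lambda>n. norm (H2_vec u - V n)) \<longlonglongrightarrow> 0"
    using lim by (simp add: V_def H2_norm_diff[OF u \<theta>H2[OF g]])
  then have V: "V \<longlonglongrightarrow> H2_vec u"
    by (simp add: tendsto_iff dist_norm norm_minus_commute)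
  have "Cauchy (\<lambda>n. H2_vec (g n))"
  proof (rule metric_CauchyI)
    fix e :: real assume "0 < e"
    then obtain N where N: "\<And>m n. m \<ge> N \<Longrightarrow> n \<ge> N \<Longrightarrow> dist (V m) (V n) < e"
      using metric_CauchyD[OF LIMSEQ_imp_Cauchy[OF V]] by blast
    have "dist (H2_vec (g m)) (H2_vec (g n)) \<le> dist (V m) (V n)" for m n
      using H2_norm_le_inner_mult[OF \<theta> H2_diff[OF g[of m] g[of n]]]
      by (simp add: dist_norm V_def H2_norm_diff[symmetric] g \<theta>H2 right_diff_distrib)
    with N show "\<exists>N. \<forall>m\<ge>N. \<forall>n\<ge>N. dist (H2_vec (g m)) (H2_vec (g n)) < e"
      by (meson le_less_trans)
  qed
  then obtain x where x: "(\<lambda>n. H2_vec (g n)) \<longlonglongrightarrow> x"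
    unfolding Cauchy_convergent_iff convergent_def ..
  obtain k where k: "k \<in> H2" "H2_vec k = x" by (rule H2_vec_surj)
  have "V \<longlonglongrightarrow> H2_vec (\<lambda>z. \<theta> z * k z)"
  proof (rule metric_tendsto_imp_tendsto)
    have "(\<lambda>n. M * dist (H2_vec (g n)) x) \<longlonglongrightarrow> M * 0"
      by (intro tendsto_intros tendsto_dist_iff[THEN iffD1, OF x])
    then show "(\<lambda>n. M * dist (H2_vec (g n)) x) \<longlonglongrightarrow> 0" by simp
    have "dist (V n) (H2_vec (\<lambda>z. \<theta> z * k z)) \<le> M * dist (H2_vec (g n)) x" for n
      using H2_mult_bounded(2)[OF hol\<theta> M H2_diff[OF g[of n] k(1)]]
      by (simp add: dist_norm V_def k(2)[symmetric] H2_norm_diff[symmetric] g k(1) \<theta>H2 right_diff_distrib)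
    moreover have "0 \<le> M" using order_trans[OF norm_ge_zero M[of 0]] by simp
    ultimately show "\<forall>\<^sub>F n in sequentially. dist (V n) (H2_vec (\<lambda>z. \<theta> z * k z)) \<le> dist (M * dist (H2_vec (g n)) x) 0"
      by simp
  qed
  then have "H2_vec u = H2_vec (\<lambda>z. \<theta> z * k z)" by (rule LIMSEQ_unique[OF V])
  then show ?thesis using H2_vec_inject[OF u \<theta>H2[OF k(1)]] k(1) by auto
qed

section \<open>Blaschke and singular inner functions\<close>

lemma inner_fun_hol: "inner_fun \<theta> \<Longrightarrow> \<theta> holomorphic_on unit_disk"
  by (simp add: inner_fun_def Hinf_def)

lemma inner_fun_H2: "inner_fun \<theta> \<Longrightarrow> \<theta> \<in> H2"
  by (simp add: inner_fun_def Hinf_subset_H2)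

text \<open>
  The ring of holomorphic functions on the disk has no zero divisors.
\<close>

lemma cancel_on_disk:
  assumes a: "a holomorphic_on unit_disk" and u: "u holomorphic_on unit_disk" and v: "v holomorphic_on unit_disk"
    and nz: "\<exists>z\<in>unit_disk. a z \<noteq> 0" and eq: "\<And>z. z \<in> unit_disk \<Longrightarrow> a z * u z = a z * v z"
    and z: "z \<in> unit_disk"
  shows "u z = v z"
proof -
  let ?S = "{z \<in> unit_disk. a z \<noteq> 0}"
  have "?S = unit_disk \<inter> a -` (- {0})" by auto
  then have "open ?S"
    using continuous_open_preimage[OF holomorphic_on_imp_continuous_on[OF a] open_ball, of "- {0}"]
    by (simp add: open_Compl)
  moreover have "?S \<noteq> {}" using nz by auto
  moreover have "?S \<subseteq> unit_disk" by blast
  ultimately show ?thesis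
    by (rule analytic_continuation_open[OF _ open_ball _ connected_ball _ u v _ z]) (use eq in auto)
qed

theorem sing_space_eq:
  assumes h: "h holomorphic_on unit_disk" and nz: "\<exists>z\<in>unit_disk. h z \<noteq> 0"
  shows "sing_space h = {g \<in> H2. quotient_hol g h}"
proof -
  have "g \<in> sing_space h \<longleftrightarrow> quotient_hol g h" if g: "g \<in> H2" for g
  proof -
    have "g \<in> sing_space h \<longleftrightarrow> Sing h \<subseteq> Sing g"
      using g by (auto simp: sing_space_def Sing_def)
    also have "\<dots> \<longleftrightarrow> quotient_hol g h"
      using quotient_hol_if_Sing_subset[OF h nz H2_hol[OF g]] Sing_mono[OF h H2_hol[OF g]] by blast
    finally show ?thesis .
  qed
  moreover have "sing_space h \<subseteq> H2" by (auto simp: sing_space_def)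
  ultimately show ?thesis by blast
qed

lemma quotient_hol_trans:
  assumes "quotient_hol f g" "quotient_hol g h"
  shows "quotient_hol f h"
proof -
  obtain k l where "k holomorphic_on unit_disk" "\<forall>z\<in>unit_disk. f z = g z * k z"
    "l holomorphic_on unit_disk" "\<forall>z\<in>unit_disk. g z = h z * l z"
    using assms unfolding quotient_hol_def by blast
  then show ?thesis unfolding quotient_hol_def
    by (intro exI[of _ "\<lambda>z. l z * k z"]) (auto intro!: holomorphic_intros)
qed

lemma quotient_hol_one_iff:
  assumes "s holomorphic_on unit_disk"
  shows "quotient_hol (\<lambda>_. 1) s \<longleftrightarrow> (\<forall>z\<in>unit_disk. s z \<noteq> 0)"
proof
  assume "\<forall>z\<in>unit_disk. s z \<noteq> 0"
  then show "quotient_hol (\<lambda>_. 1) s" unfolding quotient_hol_def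
    by (intro exI[of _ "\<lambda>z. 1 / s z"]) (auto intro!: holomorphic_intros assms)
qed (auto simp: quotient_hol_def)

lemma quotient_hol_zero_free:
  assumes "g holomorphic_on unit_disk" "s holomorphic_on unit_disk" "\<forall>z\<in>unit_disk. s z \<noteq> 0"
  shows "quotient_hol g s"
  unfolding quotient_hol_def using assms
  by (intro exI[of _ "\<lambda>z. g z / s z"]) (auto intro!: holomorphic_intros)

lemma NC_blaschke_iff:
  assumes "\<exists>z\<in>unit_disk. b z \<noteq> 0"
  shows "NC_blaschke_inner b \<longleftrightarrow> blaschke_inner b"
  using sing_space_eq[OF inner_fun_hol assms] by (auto simp: NC_blaschke_inner_def blaschke_inner_def)

text \<open>
  The singularity space is all of \<open>H\<^sup>2\<close> as soon as it contains the constant \<open>1\<close>, and \<open>s\<close> divides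
  \<open>1\<close> only if it has no zeros.
\<close>

lemma NC_singular_iff:
  assumes "\<exists>z\<in>unit_disk. s z \<noteq> 0"
  shows "NC_singular_inner s \<longleftrightarrow> singular_inner s"
proof (cases "inner_fun s")
  case True
  note s = inner_fun_hol[OF True]
  have "sing_space s = H2 \<longleftrightarrow> (\<forall>z\<in>unit_disk. s z \<noteq> 0)"
  proof
    assume "sing_space s = H2"
    then have "quotient_hol (\<lambda>_. 1) s" using sing_space_eq[OF s assms] H2_one by blast
    then show "\<forall>z\<in>unit_disk. s z \<noteq> 0" using quotient_hol_one_iff[OF s] by simp
  next
    assume "\<forall>z\<in>unit_disk. s z \<noteq> 0"
    then show "sing_space s = H2"
      using sing_space_eq[OF s assms] quotient_hol_zero_free[OF H2_hol s] by blast
  qed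
  then show ?thesis using True by (simp add: NC_singular_inner_def singular_inner_def)
qed (simp add: NC_singular_inner_def singular_inner_def)

section \<open>The two factorizations\<close>

lemma outer_fun_approx:
  "outer_fun f \<Longrightarrow> g \<in> H2 \<Longrightarrow> 0 < \<epsilon> \<Longrightarrow> \<exists>q. H2_norm (\<lambda>z. g z - poly q z * f z) < \<epsilon>"
  by (simp add: outer_fun_def)

text \<open>
  At a zero of \<open>f\<close> all functions \<open>1 - q f\<close> take the value \<open>1\<close>, which keeps their norms away from \<open>0\<close>.
\<close>

lemma outer_fun_zero_free:
  assumes f: "outer_fun f" and z: "z \<in> unit_disk"
  shows "f z \<noteq> 0"
proof
  assume 0: "f z = 0"
  have fH2: "f \<in> H2" using f by (simp add: outer_fun_def)
  have "1 - cmod z > 0" using z by simp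
  from outer_fun_approx[OF f H2_one this]
  obtain q where q: "H2_norm (\<lambda>z. 1 - poly q z * f z) < 1 - cmod z" ..
  have "(\<lambda>z. 1 - poly q z * f z) \<in> H2" by (intro H2_diff H2_one H2_mult_poly fH2)
  from H2_point_bound[OF this, of z] z q 0 show False by simp
qed

text \<open>
  Since \<open>s f\<close> has no zeros, \<open>b\<close> and \<open>h\<close> divide each other.
\<close>

lemma classical_BSO_props:
  assumes h: "h holomorphic_on unit_disk" and nz: "\<exists>z\<in>unit_disk. h z \<noteq> 0"
    and BSO: "classical_BSO Hp h b s f"
  shows "sing_space h = mult_range b" and "Sing b = Sing h" and "\<exists>z\<in>unit_disk. b z \<noteq> 0"
proof -
  have inner: "inner_fun b" "inner_fun s" and snz: "\<forall>z\<in>unit_disk. s z \<noteq> 0" and f: "outer_fun f"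
    and eq: "\<And>z. z \<in> unit_disk \<Longrightarrow> h z = b z * (s z * f z)"
    using BSO by (auto simp: classical_BSO_def blaschke_inner_def singular_inner_def mult.assoc)
  have b: "b holomorphic_on unit_disk" and s: "s holomorphic_on unit_disk" using inner inner_fun_hol by auto
  have fh: "f holomorphic_on unit_disk" using f H2_hol by (auto simp: outer_fun_def)
  show bnz: "\<exists>z\<in>unit_disk. b z \<noteq> 0" using nz eq by force
  have sf: "(\<lambda>z. s z * f z) holomorphic_on unit_disk" by (intro holomorphic_intros s fh)
  have sfnz: "s z * f z \<noteq> 0" if "z \<in> unit_disk" for z
    using snz outer_fun_zero_free[OF f that] that by auto
  have 1: "quotient_hol h b" unfolding quotient_hol_def using sf eq by blast
  have 2: "quotient_hol b h" unfolding quotient_hol_def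
  proof (intro exI conjI ballI)
    show "(\<lambda>z. 1 / (s z * f z)) holomorphic_on unit_disk" using sfnz by (intro holomorphic_intros s fh) auto
    show "b z = h z * (1 / (s z * f z))" if "z \<in> unit_disk" for z
      using eq[OF that] sfnz[OF that] by simp
  qed
  show "Sing b = Sing h" using Sing_mono[OF b h 1] Sing_mono[OF h b 2] by blast
  have "{g \<in> H2. quotient_hol g h} = {g \<in> H2. quotient_hol g b}"
    using quotient_hol_trans 1 2 by blast
  also have "\<dots> = mult_range b" using BSO by (simp add: classical_BSO_def blaschke_inner_def)
  finally show "sing_space h = mult_range b" by (simp add: sing_space_eq[OF h nz])
qed

lemma classical_iff_NC:
  assumes h: "h holomorphic_on unit_disk" and nz: "\<exists>z\<in>unit_disk. h z \<noteq> 0"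
  shows "classical_BSO Hp h b s f \<longleftrightarrow> NC_BSO Hp h b s f"
proof (cases "\<forall>z\<in>unit_disk. h z = b z * s z * f z")
  case True
  then have "\<exists>z\<in>unit_disk. b z \<noteq> 0" "\<exists>z\<in>unit_disk. s z \<noteq> 0" using nz by force+
  then show ?thesis
    using classical_BSO_props(2)[OF h nz, of Hp b s f]
    by (auto simp: classical_BSO_def NC_BSO_def NC_blaschke_iff NC_singular_iff)
qed (auto simp: classical_BSO_def NC_BSO_def)

section \<open>Uniqueness of the factors\<close>

text \<open>
  The factors satisfy \<open>k l = 1\<close> and, by comparing norms, \<open>\<parallel>k\<parallel> \<le> 1\<close> and \<open>\<parallel>l\<parallel> \<le> 1\<close>.  As
  \<open>|k(0)| \<le> \<parallel>k\<parallel>\<close> and \<open>|l(0)| \<le> \<parallel>l\<parallel>\<close>, equality holds throughout, so the coefficients of \<open>k\<close> of positive index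
  vanish.
\<close>

lemma inner_unique_if_mutual_multiples:
  assumes \<theta>: "inner_fun \<theta>" and \<tau>: "inner_fun \<tau>" and nz: "\<exists>z\<in>unit_disk. \<theta> z \<noteq> 0"
    and k: "k \<in> H2" "\<forall>z\<in>unit_disk. \<theta> z = \<tau> z * k z"
    and l: "l \<in> H2" "\<forall>z\<in>unit_disk. \<tau> z = \<theta> z * l z"
  shows "equal_up_to_unimodular \<theta> \<tau>"
proof -
  have norm_le: "H2_norm m \<le> 1"
    if "inner_fun \<alpha>" "inner_fun \<beta>" "m \<in> H2" "\<forall>z\<in>unit_disk. \<alpha> z = \<beta> z * m z" for \<alpha> \<beta> m
  proof -
    have "taylor_coeff (\<lambda>z. \<beta> z * m z) = taylor_coeff \<alpha>"
      using that(4) by (intro taylor_coeff_cong[symmetric] inner_fun_hol that(1)) simp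
    then have "H2_norm (\<lambda>z. \<beta> z * m z) = H2_norm \<alpha>" by (simp add: H2_norm_def)
    with H2_norm_le_inner_mult[OF that(2,3)] H2_norm_inner_le_1[OF that(1)] show ?thesis by simp
  qed
  have kle: "H2_norm k \<le> 1" by (rule norm_le[OF \<theta> \<tau> k])
  have lle: "H2_norm l \<le> 1" by (rule norm_le[OF \<tau> \<theta> l])
  have "k 0 * l 0 = 1"
  proof (rule cancel_on_disk[OF inner_fun_hol[OF \<theta>] _ _ nz, of "\<lambda>z. k z * l z" "\<lambda>_. 1" 0])
    show "\<theta> z * (k z * l z) = \<theta> z * 1" if "z \<in> unit_disk" for z
      using k(2) l(2) that by (metis mult.assoc mult.commute mult.right_neutral)
  qed (auto intro!: holomorphic_intros H2_hol[OF k(1)] H2_hol[OF l(1)])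
  then have "cmod (k 0) * cmod (l 0) = 1" by (metis norm_mult norm_one)
  moreover have "cmod (k 0) \<le> 1" "cmod (l 0) \<le> 1"
    using cmod_taylor_coeff_le[OF k(1), of 0] cmod_taylor_coeff_le[OF l(1), of 0] kle lle
    by (simp_all add: taylor_coeff_0)
  ultimately have k0: "cmod (k 0) = 1"
    using mult_left_le[of "cmod (l 0)" "cmod (k 0)"] by simp
  have "taylor_coeff k n = 0" if "n \<noteq> 0" for n
  proof -
    have "(\<Sum>i\<in>{0, n}. (cmod (taylor_coeff k i))\<^sup>2) \<le> (H2_norm k)\<^sup>2"
      unfolding H2_norm_sq[OF k(1)] using k(1) by (intro sum_le_suminf) (auto simp: H2_def)
    also have "\<dots> \<le> 1" using kle H2_norm_nonneg[OF k(1)] by (simp add: power_le_one)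
    finally show ?thesis using that k0 by (simp add: taylor_coeff_0)
  qed
  then have const: "(\<lambda>n. taylor_coeff k n * z ^ n) = (\<lambda>n. if n = 0 then k 0 else 0)" for z
    by (auto simp: fun_eq_iff taylor_coeff_0)
  have kz: "k z = k 0" if "z \<in> unit_disk" for z
  proof (rule sums_unique2)
    show "(\<lambda>n. taylor_coeff k n * z ^ n) sums k z"
      using that by (intro taylor_sums[OF H2_hol[OF k(1)]]) simp
    show "(\<lambda>n. taylor_coeff k n * z ^ n) sums k 0" unfolding const by (rule sums_single)
  qed
  show ?thesis
    unfolding equal_up_to_unimodular_def
  proof (intro exI conjI ballI)
    show "cmod (k 0) = 1" by (rule k0)
    show "\<theta> z = k 0 * \<tau> z" if "z \<in> unit_disk" for z
      using k(2) kz[OF that] that by (simp add: mult.commute)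
  qed
qed

text \<open>
  If \<open>q\<^sub>n f\<close> tends to \<open>1\<close>, then \<open>S q\<^sub>n F = s q\<^sub>n f\<close> tends to \<open>s\<close>, and the limit stays in the closed space
  \<open>S H\<^sup>2\<close>.
\<close>

lemma inner_multiple_if_outer:
  assumes s: "inner_fun s" and S: "inner_fun S" and f: "outer_fun f" and F: "F \<in> H2"
    and eq: "\<And>z. z \<in> unit_disk \<Longrightarrow> s z * f z = S z * F z"
  shows "\<exists>k\<in>H2. \<forall>z\<in>unit_disk. s z = S z * k z"
proof -
  have fH2: "f \<in> H2" using f by (simp add: outer_fun_def)
  obtain M where M: "\<And>z. cmod z < 1 \<Longrightarrow> cmod (s z) \<le> M"
    using s Hinf_boundE[of s] unfolding inner_fun_def by blast
  have "\<exists>q. H2_norm (\<lambda>z. 1 - poly q z * f z) < inverse (real (Suc n))" for n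
    by (rule outer_fun_approx[OF f H2_one]) simp
  then have "\<exists>q. \<forall>n. H2_norm (\<lambda>z. 1 - poly (q n) z * f z) < inverse (real (Suc n))"
    by (intro choice allI)
  then obtain q where q: "\<And>n. H2_norm (\<lambda>z. 1 - poly (q n) z * f z) < inverse (real (Suc n))" by auto
  have d: "(\<lambda>z. 1 - poly (q n) z * f z) \<in> H2" for n by (intro H2_diff H2_one H2_mult_poly fH2)
  have le: "H2_norm (\<lambda>z. s z - S z * (poly (q n) z * F z)) \<le> M * inverse (real (Suc n))" for n
  proof -
    have "taylor_coeff (\<lambda>z. s z * (1 - poly (q n) z * f z)) = taylor_coeff (\<lambda>z. s z - S z * (poly (q n) z * F z))"
    proof (rule taylor_coeff_cong)
      show "(\<lambda>z. s z * (1 - poly (q n) z * f z)) holomorphic_on unit_disk"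
        by (intro holomorphic_intros inner_fun_hol s H2_hol fH2)
      fix z :: complex assume "cmod z < 1"
      then show "s z * (1 - poly (q n) z * f z) = s z - S z * (poly (q n) z * F z)"
        using eq[of z] by (simp add: right_diff_distrib mult.left_commute)
    qed
    then have "H2_norm (\<lambda>z. s z - S z * (poly (q n) z * F z)) = H2_norm (\<lambda>z. s z * (1 - poly (q n) z * f z))"
      by (simp add: H2_norm_def)
    also have "\<dots> \<le> M * H2_norm (\<lambda>z. 1 - poly (q n) z * f z)"
      by (rule H2_mult_bounded(2)[OF inner_fun_hol[OF s] M d])
    also have "\<dots> \<le> M * inverse (real (Suc n))"
      using order_trans[OF norm_ge_zero M[of 0]] by (intro mult_left_mono less_imp_le[OF q]) simp
    finally show ?thesis .
  qed
  have "(\<lambda>n. M * inverse (real (Suc n))) \<longlonglongrightarrow> M * 0"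
    by (intro tendsto_intros LIMSEQ_inverse_real_of_nat)
  then have lim: "(\<lambda>n. M * inverse (real (Suc n))) \<longlonglongrightarrow> 0" by simp
  have SqF: "(\<lambda>z. S z * (poly (q n) z * F z)) \<in> H2" for n
    by (rule Hinf_boundE[of S], use S in \<open>simp add: inner_fun_def\<close>)
       (rule H2_mult_bounded(1)[OF inner_fun_hol[OF S] _ H2_mult_poly[OF F]])
  have "(\<lambda>n. H2_norm (\<lambda>z. s z - S z * (poly (q n) z * F z))) \<longlonglongrightarrow> 0"
    by (rule tendsto_sandwich[OF _ _ tendsto_const lim])
       (use le H2_norm_nonneg[OF H2_diff[OF inner_fun_H2[OF s] SqF]] in auto)
  then show ?thesis
    by (rule inner_range_closed[OF S inner_fun_H2[OF s] H2_mult_poly[OF F]])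
qed

text \<open>
  Both Blaschke factors span the singularity space of \<open>h\<close>, so they are multiples of each other.  After
  cancelling them, \<open>s f = S (c F)\<close> with a unimodular \<open>c\<close>, and the outer factors make \<open>s\<close> and \<open>S\<close>
  multiples of each other.
\<close>

lemma classical_BSO_unique:
  assumes h: "h holomorphic_on unit_disk" and nz: "\<exists>z\<in>unit_disk. h z \<noteq> 0"
    and 1: "classical_BSO Hp h b s f" and 2: "classical_BSO Hp h B S F"
  shows "equal_up_to_unimodular B b" "equal_up_to_unimodular S s" "equal_up_to_unimodular F f"
proof -
  have b: "inner_fun b" and s: "inner_fun s" and snz: "\<forall>z\<in>unit_disk. s z \<noteq> 0" and f: "outer_fun f"
    and eq1: "\<And>z. z \<in> unit_disk \<Longrightarrow> h z = b z * s z * f z"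
    using 1 by (auto simp: classical_BSO_def blaschke_inner_def singular_inner_def)
  have B: "inner_fun B" and S: "inner_fun S" and F: "outer_fun F"
    and eq2: "\<And>z. z \<in> unit_disk \<Longrightarrow> h z = B z * S z * F z"
    using 2 by (auto simp: classical_BSO_def blaschke_inner_def singular_inner_def)
  have fH2: "f \<in> H2" and FH2: "F \<in> H2" using f F by (auto simp: outer_fun_def)
  note props1 = classical_BSO_props[OF h nz 1] and props2 = classical_BSO_props[OF h nz 2]
  have self: "\<theta> \<in> mult_range \<theta>" if "inner_fun \<theta>" for \<theta>
    using inner_fun_H2[OF that] H2_one by (auto simp: mult_range_def intro!: bexI[of _ "\<lambda>_. 1"])
  have "B \<in> mult_range b" "b \<in> mult_range B" using self[OF b] self[OF B] props1(1) props2(1) by auto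
  then obtain k l where "k \<in> H2" "\<forall>z\<in>unit_disk. B z = b z * k z" "l \<in> H2" "\<forall>z\<in>unit_disk. b z = B z * l z"
    unfolding mult_range_def by blast
  then show Bb: "equal_up_to_unimodular B b"
    by (rule inner_unique_if_mutual_multiples[OF B b props2(3)])
  then obtain c where c: "cmod c = 1" "\<And>z. z \<in> unit_disk \<Longrightarrow> B z = c * b z"
    by (auto simp: equal_up_to_unimodular_def)
  have sf: "s z * f z = S z * (c * F z)" if "z \<in> unit_disk" for z
  proof (rule cancel_on_disk[OF inner_fun_hol[OF b] _ _ props1(3) _ that])
    show "b z * (s z * f z) = b z * (S z * (c * F z))" if "z \<in> unit_disk" for z
      using eq1[OF that] eq2[OF that] c(2)[OF that] by (auto simp: mult_ac)
  qed (intro holomorphic_intros inner_fun_hol s S H2_hol fH2 FH2)+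
  have SF: "S z * F z = s z * (cnj c * f z)" if "z \<in> unit_disk" for z
  proof -
    have "cnj c * c = 1" using c(1) by (simp add: complex_norm_square[symmetric] mult.commute[of "cnj c"])
    then have "S z * F z = cnj c * (S z * (c * F z))" by (simp add: mult_ac)
    then show ?thesis using sf[OF that] by (simp add: mult_ac)
  qed
  obtain k where k: "k \<in> H2" "\<forall>z\<in>unit_disk. s z = S z * k z"
    using inner_multiple_if_outer[OF s S f H2_cmult[OF FH2] sf] by blast
  obtain l where l: "l \<in> H2" "\<forall>z\<in>unit_disk. S z = s z * l z"
    using inner_multiple_if_outer[OF S s F H2_cmult[OF fH2] SF] by blast
  have Snz: "\<exists>z\<in>unit_disk. S z \<noteq> 0" using nz eq2 by force
  show Ss: "equal_up_to_unimodular S s"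
    by (rule inner_unique_if_mutual_multiples[OF S s Snz l k])
  then obtain d where d: "cmod d = 1" "\<And>z. z \<in> unit_disk \<Longrightarrow> S z = d * s z"
    by (auto simp: equal_up_to_unimodular_def)
  have "F z = cnj (d * c) * f z" if z: "z \<in> unit_disk" for z
  proof -
    have "s z * f z = s z * (d * c * F z)" using sf[OF z] d(2)[OF z] by (simp add: mult_ac)
    then have "f z = d * c * F z" using snz z by simp
    moreover have "cnj (d * c) * (d * c) = 1"
      using c(1) d(1) by (simp add: complex_norm_square[symmetric] mult.commute[of "cnj _"] norm_mult del: complex_cnj_mult)
    ultimately show ?thesis by (metis mult.assoc mult_1)
  qed
  then show "equal_up_to_unimodular F f"
    unfolding equal_up_to_unimodular_def using c(1) d(1)
    by (intro exI[of _ "cnj (d * c)"]) (auto simp: norm_mult)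
qed

theorem corollary5p11:
  fixes Hp :: "(complex \<Rightarrow> complex) set" and h :: "complex \<Rightarrow> complex"
  assumes "Hp \<in> {H2, Hinf}"
    and "h \<in> Hp"
    and "\<exists>z\<in>unit_disk. h z \<noteq> 0"
  shows "(\<forall>b s f. classical_BSO Hp h b s f \<longrightarrow> mult_range b = sing_space h) \<and>
         (\<forall>b s f. classical_BSO Hp h b s f \<longleftrightarrow> NC_BSO Hp h b s f) \<and>
         (\<forall>b s f B S F. classical_BSO Hp h b s f \<and> NC_BSO Hp h B S F \<longrightarrow>
            equal_up_to_unimodular B b \<and> equal_up_to_unimodular S s \<and>
            equal_up_to_unimodular F f)"
proof -
  have h: "h holomorphic_on unit_disk" using assms(1,2) H2_hol Hinf_hol by auto
  show ?thesis
    unfolding classical_iff_NC[OF h assms(3), symmetric]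
  proof (intro conjI allI impI)
    fix b s f
    assume "classical_BSO Hp h b s f"
    then show "mult_range b = sing_space h" by (rule classical_BSO_props(1)[OF h assms(3), symmetric])
  next
    fix b s f B S F
    assume "classical_BSO Hp h b s f \<and> classical_BSO Hp h B S F"
    then have BSO: "classical_BSO Hp h b s f" "classical_BSO Hp h B S F" by simp_all
    show "equal_up_to_unimodular B b" "equal_up_to_unimodular S s" "equal_up_to_unimodular F f"
      by (rule classical_BSO_unique[OF h assms(3) BSO])+
  qed (rule refl)
qed

end
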